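(* Fix any $s\in\mathbb{R}_+$. In the league model described in the context (with the stated assumptions on $f$, $\mu$, $\nu$ and $\bm\xi$), for $\mu^{\mathbb{N}}$-almost every sequence $\vec{s}=(s_i)_{i\in\mathbb{N}}\in\mathbb{R}_+^{\mathbb{N}}$, under $\mathbb{P}_{\vec{s}}$, $$\frac{\bm W_n(s)}{2n}\longrightarrow \ell(s)\quad\text{in probability as } n\to\infty,$$ where $$\ell(s)=\mathbb{E}\left[f\left(s\cdot\bm V,\bm U\cdot\bm V'\right)\right]=\int_{\mathbb{R}_+^3} f\left(s\cdot v,u\cdot v'\right)\,d\nu(v)\,d\nu(v')\,d\mu(u).$$ Here $\bm V,\bm V',\bm U$ are independent, $\bm V$ and $\bm V'$ have law $\nu$, and $\bm U$ has law $\mu$.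
   Context: Notation: $\mathbb{N}=\{1,2,\dots\}$, $[n]=\{1,\dots,n\}$, $[n]_0=\{0,1,\dots,n\}$, $\mathbb{R}_+=[0,\infty)$. Random quantities are in bold. Assumptions on $f$: $f:\mathbb{R}_+^2\to[0,1]$ is measurable, weakly increasing in its first variable, weakly decreasing in its second variable, and $f(x,y)+f(y,x)=1$ for all $x,y\in\mathbb{R}_+$. Assumptions on $\mu,\nu,\bm\xi$: $\mu$ and $\nu$ are Borel probability measures on $\mathbb{R}_+$. $\bm\xi=(\bm\xi_\ell)_{\ell\in\mathbb{N}}$ is an $\mathbb{R}_+$-valued process such that: each $\bm\xi_\ell$ has law $\nu$; $(\bm\xi_\ell,\bm\xi_k)\stackrel{d}{=}(\bm\xi_{\ell+\tau},\bm\xi_{k+\tau})$ for all $\ell,k,\tau\in\mathbb{N}$; and $\bm\xi$ is weakly mixing, i.e. for every $A\in\sigma(\bm\xi_1)$ and every collection of sets $B_\ell\in\sigma(\bm\xi_\ell)$, $\frac1n\sum_{\ell=1}^n|\mathbb{P}(A\cap B_\ell)-\mathbb{P}(A)\mathbb{P}(B_\ell)|\to0$ as $n\to\infty$. The league with $2n$ teams: the teams are $T_0,\dots,T_{2n-1}$. There are $2n-1$ days; the calendar is deterministic and fixed in advance (for each $n$), every team plays exactly one match each day, and over the $2n-1$ days each team plays every other team exactly once. Team $T_i$ has initial strength $\bm s_i\in\mathbb{R}_+$ and its strength on day $p$ is $\bm s_i\cdot\bm\xi^i_p$, where the processes $\bm\xi^i=(\bm\xi^i_p)_{p\in\mathbb{N}}$,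 $i\in[2n-1]_0$, are independent copies of $\bm\xi$. The initial strength of $T_0$ is deterministic, $\bm s_0=s$; the initial strengths $\bm s_i$, $i\geq1$, are i.i.d. with law $\mu$ and independent of all the processes $\bm\xi^i$ and of $\bm\xi$. If $T_i$ and $T_j$ play on day $p$, then, conditionally on the strengths, $T_i$ wins with probability $f(\bm s_i\bm\xi^i_p,\bm s_j\bm\xi^j_p)$ and otherwise $T_j$ wins (no draws); conditionally on the strengths of the teams, the results of different matches are independent. $\bm W_n(s)$ is the number of wins of $T_0$ at the end of the league with $2n$ teams. For a deterministic sequence $\vec{s}=(s_i)_{i\in\mathbb{N}}\in\mathbb{R}_+^{\mathbb{N}}$, $\mathbb{P}_{\vec{s}}$ denotes the law in the model where the initial strengths of the teams $T_i$, $i\in[2n-1]$, are equal to the deterministic values $s_i$ (and $T_0$ has initial strength $s$). *)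

theory Defs
  imports "HOL-Probability.Probability"
begin

abbreviation Rplus :: "real measure" where
  "Rplus \<equiv> restrict_space borel {0..}"

text \<open>A Borel probability measure on \<open>[0,\<infinity>)\<close>; its underlying space is \<open>[0,\<infinity>)\<close> itself.\<close>

definition borel_prob_Rplus :: "real measure \<Rightarrow> bool" where
  "borel_prob_Rplus \<mu> \<longleftrightarrow> prob_space \<mu> \<and> sets \<mu> = sets Rplus"

definition win_function :: "(real \<Rightarrow> real \<Rightarrow> real) \<Rightarrow> bool" where
  "win_function f \<longleftrightarrow>
     (\<lambda>(x, y). f x y) \<in> borel_measurable (Rplus \<Otimes>\<^sub>M Rplus) \<and>
     (\<forall>x\<ge>0. \<forall>y\<ge>0. 0 \<le> f x y \<and> f x y \<le> 1) \<and>
     (\<forall>x\<ge>0. \<forall>x'\<ge>x. \<forall>y\<ge>0. f x y \<le> f x' y) \<and>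
     (\<forall>x\<ge>0. \<forall>y\<ge>0. \<forall>y'\<ge>y. f x y' \<le> f x y) \<and>
     (\<forall>x\<ge>0. \<forall>y\<ge>0. f x y + f y x = 1)"

text \<open>
  Days and the entries of processes are indexed by \<open>1, 2, \<dots>\<close>; the value at index \<open>0\<close>
  of a function on \<open>nat\<close> representing a process is irrelevant.
\<close>

definition weakly_mixing :: "'a measure \<Rightarrow> (nat \<Rightarrow> 'a \<Rightarrow> real) \<Rightarrow> bool" where
  "weakly_mixing P \<xi> \<longleftrightarrow>
     (\<forall>A \<in> sets (vimage_algebra (space P) (\<xi> 1) Rplus). \<forall>B.
        (\<forall>l\<ge>1. B l \<in> sets (vimage_algebra (space P) (\<xi> l) Rplus)) \<longrightarrow>
        (\<lambda>n. (\<Sum>l=1..n. \<bar>measure P (A \<inter> B l) - measure P A * measure P (B l)\<bar>) / real n)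
          \<longlonglongrightarrow> 0)"

definition strength_process ::
  "'a measure \<Rightarrow> real measure \<Rightarrow> (nat \<Rightarrow> 'a \<Rightarrow> real) \<Rightarrow> bool" where
  "strength_process P \<nu> \<xi> \<longleftrightarrow>
     prob_space P \<and>
     (\<forall>l\<ge>1. \<xi> l \<in> measurable P Rplus \<and> distr P Rplus (\<xi> l) = \<nu>) \<and>
     (\<forall>l\<ge>1. \<forall>k\<ge>1. \<forall>\<tau>\<ge>1.
        distr P (Rplus \<Otimes>\<^sub>M Rplus) (\<lambda>\<omega>. (\<xi> l \<omega>, \<xi> k \<omega>)) =
        distr P (Rplus \<Otimes>\<^sub>M Rplus) (\<lambda>\<omega>. (\<xi> (l + \<tau>) \<omega>, \<xi> (k + \<tau>) \<omega>))) \<and>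
     weakly_mixing P \<xi>"

definition path :: "(nat \<Rightarrow> 'a \<Rightarrow> real) \<Rightarrow> 'a \<Rightarrow> nat \<Rightarrow> real" where
  "path X \<omega> = (\<lambda>p\<in>{1..}. X p \<omega>)"

abbreviation path_space :: "(nat \<Rightarrow> real) measure" where
  "path_space \<equiv> PiM {1..} (\<lambda>_. Rplus)"

text \<open>\<open>opp p i\<close> is the opponent of team \<open>i\<close> on day \<open>p\<close> in a league with \<open>2n\<close> teams.\<close>

definition calendar :: "nat \<Rightarrow> (nat \<Rightarrow> nat \<Rightarrow> nat) \<Rightarrow> bool" where
  "calendar n opp \<longleftrightarrow>
     (\<forall>p\<in>{1..2*n-1}. \<forall>i<2*n. opp p i < 2*n \<and> opp p i \<noteq> i \<and> opp p (opp p i) = i) \<and>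
     (\<forall>i<2*n. \<forall>j<2*n. i \<noteq> j \<longrightarrow> (\<exists>!p. p \<in> {1..2*n-1} \<and> opp p i = j))"

text \<open>Each match is listed once, as (team with the smaller label, day).\<close>

definition matches :: "nat \<Rightarrow> (nat \<Rightarrow> nat \<Rightarrow> nat) \<Rightarrow> (nat \<times> nat) set" where
  "matches n opp = {(i, p). i < 2*n \<and> p \<in> {1..2*n-1} \<and> i < opp p i}"

definition strength ::
  "(nat \<Rightarrow> real) \<Rightarrow> (nat \<Rightarrow> nat \<Rightarrow> 'b \<Rightarrow> real) \<Rightarrow> nat \<Rightarrow> nat \<Rightarrow> 'b \<Rightarrow> real" where
  "strength a X i p \<omega> = a i * X i p \<omega>"

text \<open>The \<open>\<sigma>\<close>-algebra generated by the strengths of all teams on all days of the league.\<close>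

definition strength_algebra ::
  "nat \<Rightarrow> (nat \<Rightarrow> real) \<Rightarrow> 'b measure \<Rightarrow> (nat \<Rightarrow> nat \<Rightarrow> 'b \<Rightarrow> real) \<Rightarrow> 'b measure" where
  "strength_algebra n a M X =
     vimage_algebra (space M)
       (\<lambda>\<omega>. \<lambda>(i, p)\<in>{..<2*n} \<times> {1..2*n-1}. strength a X i p \<omega>)
       (PiM ({..<2*n} \<times> {1..2*n-1}) (\<lambda>_. Rplus))"

text \<open>
  A realization, on a probability space \<open>M\<close>, of the league with \<open>2n\<close> teams and deterministic
  initial strengths \<open>a i\<close>, where \<open>won i p\<close> means that team \<open>i\<close> wins its match on day \<open>p\<close>.
  The last clause gives the joint conditional law of the results given the strengths: the product
  formula for all sets of matches \<open>J\<close> expresses both the conditional independence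
  and (for singletons) the conditional winning probabilities.
\<close>

definition league ::
  "nat \<Rightarrow> (nat \<Rightarrow> nat \<Rightarrow> nat) \<Rightarrow> (real \<Rightarrow> real \<Rightarrow> real) \<Rightarrow> (nat \<Rightarrow> real) \<Rightarrow>
   'a measure \<Rightarrow> (nat \<Rightarrow> 'a \<Rightarrow> real) \<Rightarrow>
   'b measure \<Rightarrow> (nat \<Rightarrow> nat \<Rightarrow> 'b \<Rightarrow> real) \<Rightarrow> (nat \<Rightarrow> nat \<Rightarrow> 'b \<Rightarrow> bool) \<Rightarrow> bool" where
  "league n opp f a P \<xi> M X won \<longleftrightarrow>
     prob_space M \<and>
     prob_space.indep_vars M (\<lambda>_. path_space) (\<lambda>i. path (X i)) {..<2*n} \<and>
     (\<forall>i<2*n. distr M path_space (path (X i)) = distr P path_space (path \<xi>)) \<and>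
     (\<forall>i<2*n. \<forall>p\<in>{1..2*n-1}. {\<omega>\<in>space M. won i p \<omega>} \<in> sets M \<and>
        (\<forall>\<omega>\<in>space M. won (opp p i) p \<omega> \<longleftrightarrow> \<not> won i p \<omega>)) \<and>
     (\<forall>J\<subseteq>matches n opp. AE \<omega> in M.
        real_cond_exp M (strength_algebra n a M X)
          (indicator {\<omega>\<in>space M. \<forall>(i, p)\<in>J. won i p \<omega>}) \<omega> =
        (\<Prod>(i, p)\<in>J. f (strength a X i p \<omega>) (strength a X (opp p i) p \<omega>)))"

text \<open>The number of wins of team \<open>0\<close> at the end of the league.\<close>

definition wins :: "nat \<Rightarrow> (nat \<Rightarrow> nat \<Rightarrow> 'b \<Rightarrow> bool) \<Rightarrow> 'b \<Rightarrow> nat" where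
  "wins n won \<omega> = card {p\<in>{1..2*n-1}. won 0 p \<omega>}"

text \<open>
  Convergence in probability to a constant of random variables \<open>Y n\<close>, each
  defined on its own probability space \<open>M n\<close>.
\<close>

definition tendsto_in_probability ::
  "(nat \<Rightarrow> 'b measure) \<Rightarrow> (nat \<Rightarrow> 'b \<Rightarrow> real) \<Rightarrow> real \<Rightarrow> bool" where
  "tendsto_in_probability M Y c \<longleftrightarrow>
     (\<forall>\<epsilon>>0. (\<lambda>n. measure (M n) {\<omega>\<in>space (M n). \<bar>Y n \<omega> - c\<bar> > \<epsilon>}) \<longlonglongrightarrow> 0)"

definition limit_wins ::
  "(real \<Rightarrow> real \<Rightarrow> real) \<Rightarrow> real measure \<Rightarrow> real measure \<Rightarrow> real \<Rightarrow> real" where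
  "limit_wins f \<mu> \<nu> s =
     (\<integral>(v, v', u). f (s * v) (u * v') \<partial>(\<nu> \<Otimes>\<^sub>M \<nu> \<Otimes>\<^sub>M \<mu>))"

end

theory Submission
  imports Defs
begin

text \<open>
  Write \<open>F u x = \<integral>v. f (s * x) (u * v) \<partial>\<nu>\<close> for the probability that \<open>T\<^sub>0\<close>, with current
  strength \<open>s * x\<close>, beats an opponent of initial strength \<open>u\<close>. The mean number of wins is the
  sum of \<open>\<integral>F (s\<^sub>i) d\<nu>\<close> over all opponents, whatever the calendar, so the strong law of large
  numbers identifies the limit of its average. By Chebyshev's inequality it remains to see that
  the variance is \<open>o(n\<^sup>2)\<close>. Opponents on different days are different and independent, so the
  wins on days \<open>p \<noteq> q\<close> against opponents of strengths \<open>u\<close> and \<open>w\<close> have covariance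
  \<open>Cov (F u (\<xi>\<^sub>p)) (F w (\<xi>\<^sub>q))\<close>.

  For fixed \<open>u\<close> and \<open>w\<close>, stationarity and weak mixing make the average of these covariances over
  all \<open>p, q\<close> vanish, but here \<open>u\<close> and \<open>w\<close> vary with \<open>p\<close>, \<open>q\<close> and \<open>n\<close>. Since \<open>F u\<close> is decreasing
  in \<open>u\<close> with values in \<open>[0,1]\<close>, the family \<open>F\<close> is totally bounded in $L^1(\nu)$, and covariances of
  \<open>[0,1]\<close>-valued variables are Lipschitz for the $L^1$ distance, so finitely many pairs suffice.
\<close>

section \<open>The strong law for bounded functions\<close>

text \<open>The coordinates of the product space are independent with law \<open>N\<close>, so
  Hoeffding's inequality bounds the deviation probabilities of the averages by a geometric sequence.
  Its summability and the Borel-Cantelli lemma give almost sure convergence.\<close>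

lemma strong_law_bounded:
  fixes g :: "'a \<Rightarrow> real"
  assumes "prob_space N" and g: "g \<in> borel_measurable N"
    and g01: "\<And>x. x \<in> space N \<Longrightarrow> g x \<in> {0..1}"
  shows "AE sv in PiM {1..} (\<lambda>_::nat. N).
           (\<lambda>n. (\<Sum>i=1..n. g (sv i)) / real n) \<longlonglongrightarrow> (\<integral>x. g x \<partial>N)"
proof -
  interpret N: prob_space N by fact
  let ?S = "PiM {1::nat..} (\<lambda>_. N)"
  interpret S: prob_space ?S using assms(1) by (intro prob_space_PiM)
  note [measurable] = g
  define m where "m = (\<integral>x. g x \<partial>N)"
  have comp: "distr ?S N (\<lambda>\<omega>. \<omega> i) = N" if "i \<ge> 1" for i
    using distr_PiM_component[of "{1..}" "\<lambda>_. N" i] that assms(1) by auto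
  have gm[measurable]: "(\<lambda>sv. g (sv i)) \<in> borel_measurable ?S" if "i \<ge> 1" for i
    using that by (intro measurable_compose[OF _ g] measurable_component_singleton) auto
  have Eg: "S.expectation (\<lambda>sv. g (sv 1)) = m"
    unfolding m_def by (subst (2) comp[of 1, symmetric]) (simp_all add: integral_distr)
  have bound: "S.prob {x\<in>space ?S. \<bar>(\<Sum>i\<in>{1..n}. g (x i)) / n - m\<bar> \<ge> e}
      \<le> 2 * exp (-2 * real n * e\<^sup>2)" if "n \<ge> 1" "e > 0" for n :: nat and e
  proof -
    \<comment> \<open>Restricting the infinite product to finitely many coordinates gives the
      product of their laws, which is the criterion for independence in terms of joint laws.\<close>
    have "distr ?S (\<Pi>\<^sub>M i\<in>{1..n}. N) (\<lambda>\<omega>. \<lambda>i\<in>{1..n}. \<omega> i) = (\<Pi>\<^sub>M i\<in>{1..n}. N)"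
      using distr_PiM_reindex[of "{1..}" "\<lambda>_. N" "\<lambda>i. i" "{1..n}"] assms(1) by auto
    also have "\<dots> = (\<Pi>\<^sub>M i\<in>{1..n}. distr ?S N (\<lambda>\<omega>. \<omega> i))"
      by (rule PiM_cong[OF refl]) (rule comp[symmetric], simp)
    finally have "S.indep_vars (\<lambda>_. N) (\<lambda>i \<omega>. \<omega> i) {1..n}"
      using that by (subst S.indep_vars_iff_distr_eq_PiM') auto
    then have ind: "S.indep_vars (\<lambda>_. borel) (\<lambda>i \<omega>. g (\<omega> i)) {1..n}"
      by (rule S.indep_vars_compose2) simp
    have dist: "distr ?S borel (\<lambda>\<omega>. g (\<omega> i)) = distr ?S borel (\<lambda>\<omega>. g (\<omega> 1))"
      if "i \<ge> 1" for i
    proof -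
      have "distr ?S borel (\<lambda>\<omega>. g (\<omega> j)) = distr N borel g" if "j \<ge> 1" for j
        using that by (subst (2) comp[OF that, symmetric]) (simp add: distr_distr o_def)
      then show ?thesis using that by simp
    qed
    have "AE \<omega> in ?S. g (\<omega> 1) \<in> {0..1}"
      by (rule AE_I2, rule g01) (auto simp: space_PiM PiE_iff)
    then interpret H: Hoeffding_ineq_iid ?S "{1..n}" "\<lambda>i \<omega>. g (\<omega> i)" "\<lambda>\<omega>. g (\<omega> 1)" 0 1 m
      apply unfold_locales
      subgoal by (rule finite_atLeastAtMost)
      subgoal by (rule ind)
      subgoal for i using dist[of i] by simp
      subgoal using gm[of 1] by simp
      subgoal .
      subgoal using Eg by simp
      done
    show ?thesis
      using H.Hoeffding_ineq_abs_ge'[of e] that by simp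
  qed
  \<comment> \<open>Countably many tolerances \<open>1/(k+1)\<close> allow the null sets to be
    combined. Averages over \<open>Suc n\<close> terms avoid the empty average, which
    \<open>bound\<close> does not cover; the shift is undone at the end.\<close>
  have "AE x in ?S. \<forall>k::nat. \<forall>\<^sub>F n in sequentially.
      \<bar>(\<Sum>i\<in>{1..Suc n}. g (x i)) / real (Suc n) - m\<bar> < inverse (Suc k)"
    unfolding AE_all_countable
  proof
    fix k :: nat
    define e where "e = inverse (real (Suc k))"
    have e: "e > 0" by (simp add: e_def)
    define B where
      "B n = {x\<in>space ?S. \<bar>(\<Sum>i\<in>{1..Suc n}. g (x i)) / real (Suc n) - m\<bar> \<ge> e}" for n
    have mB[measurable]: "B n \<in> sets ?S" for n unfolding B_def by measurable
    have sm: "summable (\<lambda>n. 2 * exp (-2 * e\<^sup>2) * exp (-2 * e\<^sup>2) ^ n)"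
      using e by (intro summable_mult summable_geometric) simp
    have "summable (\<lambda>n. measure ?S (B n))"
    proof (rule summable_comparison_test'[OF sm, of 0])
      fix n
      have "measure ?S (B n) \<le> 2 * exp (-2 * real (Suc n) * e\<^sup>2)"
        unfolding B_def using bound[of "Suc n" e] e by simp
      also have "\<dots> = 2 * exp (-2 * e\<^sup>2) * exp (-2 * e\<^sup>2) ^ n"
        by (simp add: exp_of_nat_mult[symmetric] exp_add[symmetric] algebra_simps)
      finally show "norm (measure ?S (B n)) \<le> 2 * exp (-2 * e\<^sup>2) * exp (-2 * e\<^sup>2) ^ n"
        by simp
    qed
    then have "AE x in ?S. \<forall>\<^sub>F n in sequentially. x \<in> space ?S - B n"
      by (rule borel_cantelli_AE1[rotated 2])
        (simp_all only: mB S.emeasure_eq_measure ennreal_less_top infinity_ennreal_def)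
    then show "AE x in ?S. \<forall>\<^sub>F n in sequentially.
        \<bar>(\<Sum>i\<in>{1..Suc n}. g (x i)) / real (Suc n) - m\<bar> < inverse (Suc k)"
      by eventually_elim (auto simp: B_def e_def elim!: eventually_mono)
  qed
  then show ?thesis
  proof eventually_elim
    case (elim x)
    have "(\<lambda>n. (\<Sum>i=1..Suc n. g (x i)) / real (Suc n)) \<longlonglongrightarrow> m"
    proof (rule tendstoI)
      fix e :: real assume "e > 0"
      then obtain k :: nat where k: "inverse (Suc k) < e" using reals_Archimedean by blast
      show "\<forall>\<^sub>F n in sequentially. dist ((\<Sum>i=1..Suc n. g (x i)) / real (Suc n)) m < e"
        using elim[rule_format, of k] by eventually_elim (use k in \<open>simp add: dist_real_def\<close>)
    qed
    then show ?case unfolding m_def by (rule LIMSEQ_imp_Suc)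
  qed
qed

section \<open>Covariances and joint laws\<close>

definition covariance :: "'a measure \<Rightarrow> ('a \<Rightarrow> real) \<Rightarrow> ('a \<Rightarrow> real) \<Rightarrow> real" where
  "covariance M X Y = (\<integral>x. X x * Y x \<partial>M) - (\<integral>x. X x \<partial>M) * (\<integral>x. Y x \<partial>M)"

text \<open>The bounds are required only on the underlying space, because \<open>f\<close> is
  controlled only for nonnegative arguments. On a probability space these conditions already give
  integrability.\<close>

definition unit_valued :: "'a measure \<Rightarrow> ('a \<Rightarrow> real) \<Rightarrow> bool" where
  "unit_valued M X \<longleftrightarrow> X \<in> borel_measurable M \<and> (\<forall>x\<in>space M. 0 \<le> X x \<and> X x \<le> 1)"

lemma unit_valuedD:
  assumes "unit_valued M X"
  shows "X \<in> borel_measurable M" "x \<in> space M \<Longrightarrow> 0 \<le> X x" "x \<in> space M \<Longrightarrow> X x \<le> 1"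
    "x \<in> space M \<Longrightarrow> \<bar>X x\<bar> \<le> 1"
  using assms by (auto simp: unit_valued_def)

lemma unit_valued_comp:
  assumes "unit_valued N F" "X \<in> measurable M N"
  shows "unit_valued M (\<lambda>\<omega>. F (X \<omega>))"
  using assms measurable_space[OF assms(2)] by (auto simp: unit_valued_def)

lemma unit_valued_mult:
  assumes "unit_valued M X" "unit_valued M Y"
  shows "unit_valued M (\<lambda>\<omega>. X \<omega> * Y \<omega>)"
  using assms by (auto simp: unit_valued_def intro: mult_le_one)

lemma unit_valued_indicator: "A \<in> sets N \<Longrightarrow> unit_valued N (indicator A)"
  by (auto simp: unit_valued_def indicator_def)

context prob_space
begin

lemma unit_valued_integrable:
  assumes "unit_valued M X"
  shows "integrable M X"
  using unit_valuedD[OF assms] by (intro integrable_const_bound[where B=1]) auto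

lemma unit_valued_expectation:
  assumes "unit_valued M X"
  shows "0 \<le> expectation X" "expectation X \<le> 1"
proof -
  show "0 \<le> expectation X"
    using unit_valuedD[OF assms] by (intro integral_nonneg_AE) auto
  show "expectation X \<le> 1"
    using unit_valuedD[OF assms] unit_valued_integrable[OF assms]
    by (intro integral_le_const) auto
qed

text \<open>Replacing one argument at a time writes the difference as the mean of
  \<open>(X - X') * (Y - E Y) + (Y - Y') * (X' - E X')\<close>, and the centred factors are at most
  1 in absolute value.\<close>

lemma covariance_diff_le:
  assumes X: "unit_valued M X" and X': "unit_valued M X'"
    and Y: "unit_valued M Y" and Y': "unit_valued M Y'"
  shows "\<bar>covariance M X Y - covariance M X' Y'\<bar> \<le>
    expectation (\<lambda>\<omega>. \<bar>X \<omega> - X' \<omega>\<bar>) + expectation (\<lambda>\<omega>. \<bar>Y \<omega> - Y' \<omega>\<bar>)"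
proof -
  note i[simp] = unit_valued_integrable[OF X] unit_valued_integrable[OF X']
     unit_valued_integrable[OF Y] unit_valued_integrable[OF Y']
     unit_valued_integrable[OF unit_valued_mult[OF X Y]]
     unit_valued_integrable[OF unit_valued_mult[OF X' Y]]
     unit_valued_integrable[OF unit_valued_mult[OF X' Y']]
  note e = unit_valued_expectation[OF X'] unit_valued_expectation[OF Y]
  let ?a = "\<lambda>\<omega>. (X \<omega> - X' \<omega>) * (Y \<omega> - expectation Y)"
  let ?b = "\<lambda>\<omega>. (Y \<omega> - Y' \<omega>) * (X' \<omega> - expectation X')"
  have eq: "covariance M X Y - covariance M X' Y' = expectation (\<lambda>\<omega>. ?a \<omega> + ?b \<omega>)"
    by (simp add: covariance_def algebra_simps prob_space)
  have le: "expectation (\<lambda>\<omega>. \<bar>?a \<omega> + ?b \<omega>\<bar>) \<le> expectation (\<lambda>\<omega>. \<bar>X \<omega> - X' \<omega>\<bar> + \<bar>Y \<omega> - Y' \<omega>\<bar>)"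
  proof (rule integral_mono)
    show "integrable M (\<lambda>\<omega>. \<bar>?a \<omega> + ?b \<omega>\<bar>)"
      by (intro integrable_abs) (simp add: algebra_simps)
    show "integrable M (\<lambda>\<omega>. \<bar>X \<omega> - X' \<omega>\<bar> + \<bar>Y \<omega> - Y' \<omega>\<bar>)" by simp
    fix \<omega> assume w: "\<omega> \<in> space M"
    have "\<bar>Y \<omega> - expectation Y\<bar> \<le> 1" "\<bar>X' \<omega> - expectation X'\<bar> \<le> 1"
      using unit_valuedD(2,3)[OF Y w] unit_valuedD(2,3)[OF X' w] e by linarith+
    then have "\<bar>?a \<omega>\<bar> \<le> \<bar>X \<omega> - X' \<omega>\<bar>" "\<bar>?b \<omega>\<bar> \<le> \<bar>Y \<omega> - Y' \<omega>\<bar>"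
      unfolding abs_mult by (simp_all add: mult_left_le)
    then show "\<bar>?a \<omega> + ?b \<omega>\<bar> \<le> \<bar>X \<omega> - X' \<omega>\<bar> + \<bar>Y \<omega> - Y' \<omega>\<bar>" by linarith
  qed
  from order_trans[OF integral_abs_bound le] show ?thesis unfolding eq by simp
qed

lemma covariance_abs_le_1:
  assumes X: "unit_valued M X" and Y: "unit_valued M Y"
  shows "\<bar>covariance M X Y\<bar> \<le> 1"
proof -
  have "0 \<le> expectation X * expectation Y" "expectation X * expectation Y \<le> 1"
    using unit_valued_expectation[OF X] unit_valued_expectation[OF Y]
    by (auto intro: mult_le_one)
  then show ?thesis
    using unit_valued_expectation[OF unit_valued_mult[OF X Y]] by (simp add: covariance_def)
qed

lemma covariance_sum_sum:
  assumes "\<And>i. i \<in> I \<Longrightarrow> unit_valued M (X i)" "\<And>j. j \<in> J \<Longrightarrow> unit_valued M (Y j)"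
  shows "covariance M (\<lambda>\<omega>. \<Sum>i\<in>I. X i \<omega>) (\<lambda>\<omega>. \<Sum>j\<in>J. Y j \<omega>) =
    (\<Sum>i\<in>I. \<Sum>j\<in>J. covariance M (X i) (Y j))"
proof -
  have "expectation (\<lambda>\<omega>. (\<Sum>i\<in>I. X i \<omega>) * (\<Sum>j\<in>J. Y j \<omega>)) =
      (\<Sum>i\<in>I. \<Sum>j\<in>J. expectation (\<lambda>\<omega>. X i \<omega> * Y j \<omega>))"
    using assms unfolding sum_product
    by (simp add: Bochner_Integration.integral_sum Bochner_Integration.integrable_sum
         unit_valued_integrable unit_valued_mult)
  moreover have "expectation (\<lambda>\<omega>. \<Sum>i\<in>I. X i \<omega>) = (\<Sum>i\<in>I. expectation (X i))"
    using assms by (intro Bochner_Integration.integral_sum unit_valued_integrable)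
  moreover have "expectation (\<lambda>\<omega>. \<Sum>i\<in>J. Y i \<omega>) = (\<Sum>i\<in>J. expectation (Y i))"
    using assms by (intro Bochner_Integration.integral_sum unit_valued_integrable)
  ultimately show ?thesis
    by (simp add: covariance_def sum_product sum_subtractf)
qed

lemma covariance_scale:
  "covariance M (\<lambda>\<omega>. c * X \<omega>) (\<lambda>\<omega>. d * Y \<omega>) = c * d * covariance M X Y"
proof -
  have "(\<lambda>\<omega>. c * X \<omega> * (d * Y \<omega>)) = (\<lambda>\<omega>. c * d * (X \<omega> * Y \<omega>))" by (simp add: mult_ac fun_eq_iff)
  then show ?thesis by (simp add: covariance_def algebra_simps)
qed

section \<open>Joint laws of two or three members of an independent family\<close>

lemma indep_vars_pair_distr:
  assumes "indep_vars N X I" "i \<in> I" "j \<in> I" "i \<noteq> j"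
  shows "distr M (N i \<Otimes>\<^sub>M N j) (\<lambda>\<omega>. (X i \<omega>, X j \<omega>)) =
    distr M (N i) (X i) \<Otimes>\<^sub>M distr M (N j) (X j)"
proof -
  have "indep_var (PiM {i} N) (\<lambda>\<omega>. restrict (\<lambda>i. X i \<omega>) {i})
      (PiM {j} N) (\<lambda>\<omega>. restrict (\<lambda>i. X i \<omega>) {j})"
    using assms by (intro indep_var_restrict[where I=I]) auto
  then have "indep_var (N i) ((\<lambda>h. h i) \<circ> (\<lambda>\<omega>. restrict (\<lambda>i. X i \<omega>) {i}))
      (N j) ((\<lambda>h. h j) \<circ> (\<lambda>\<omega>. restrict (\<lambda>i. X i \<omega>) {j}))"
    by (rule indep_var_compose) simp_all
  then show ?thesis
    unfolding indep_var_distribution_eq by (simp add: o_def)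
qed

text \<open>The blocks \<open>{i}\<close> and \<open>{j,k}\<close> are independent, which splits off
  the first factor; the lemma for pairs splits the second block.\<close>

lemma indep_vars_triple_distr:
  assumes "indep_vars N X I" "i \<in> I" "j \<in> I" "k \<in> I" "i \<noteq> j" "i \<noteq> k" "j \<noteq> k"
  shows "distr M (N i \<Otimes>\<^sub>M N j \<Otimes>\<^sub>M N k) (\<lambda>\<omega>. (X i \<omega>, X j \<omega>, X k \<omega>)) =
    distr M (N i) (X i) \<Otimes>\<^sub>M distr M (N j) (X j) \<Otimes>\<^sub>M distr M (N k) (X k)"
proof -
  let ?R1 = "\<lambda>\<omega>. restrict (\<lambda>i. X i \<omega>) {i}" and ?R2 = "\<lambda>\<omega>. restrict (\<lambda>i. X i \<omega>) {j,k}"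
  have "indep_var (PiM {i} N) ?R1 (PiM {j,k} N) ?R2"
    using assms by (intro indep_var_restrict[where I=I]) auto
  then have eq: "distr M (PiM {i} N) ?R1 \<Otimes>\<^sub>M distr M (PiM {j,k} N) ?R2 =
      distr M (PiM {i} N \<Otimes>\<^sub>M PiM {j,k} N) (\<lambda>\<omega>. (?R1 \<omega>, ?R2 \<omega>))"
    unfolding indep_var_distribution_eq by simp
  have [measurable]: "random_variable (N i) (X i)" "random_variable (N j) (X j)"
      "random_variable (N k) (X k)"
    using assms by (auto simp: indep_vars_def)
  have [measurable]: "random_variable (PiM {i} N) ?R1" "random_variable (PiM {j,k} N) ?R2"
    by (auto intro!: measurable_restrict)
  have "distr M (N i) (X i) \<Otimes>\<^sub>M distr M (N j) (X j) \<Otimes>\<^sub>M distr M (N k) (X k) =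
      distr M (N i) (X i) \<Otimes>\<^sub>M distr M (N j \<Otimes>\<^sub>M N k) (\<lambda>\<omega>. (X j \<omega>, X k \<omega>))"
    using indep_vars_pair_distr[of N X I j k] assms by simp
  also have "\<dots> = distr (distr M (PiM {i} N) ?R1) (N i) (\<lambda>h. h i) \<Otimes>\<^sub>M
      distr (distr M (PiM {j,k} N) ?R2) (N j \<Otimes>\<^sub>M N k) (\<lambda>h. (h j, h k))"
    by (simp add: distr_distr o_def)
  also have "\<dots> = distr (distr M (PiM {i} N \<Otimes>\<^sub>M PiM {j,k} N) (\<lambda>\<omega>. (?R1 \<omega>, ?R2 \<omega>)))
      (N i \<Otimes>\<^sub>M (N j \<Otimes>\<^sub>M N k)) (\<lambda>(x, h). (x i, (h j, h k)))"
    unfolding eq[symmetric]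
    by (rule pair_measure_distr)
      (auto intro!: prob_space_imp_sigma_finite prob_space.prob_space_distr prob_space_distr)
  also have "\<dots> = distr M (N i \<Otimes>\<^sub>M N j \<Otimes>\<^sub>M N k) (\<lambda>\<omega>. (X i \<omega>, X j \<omega>, X k \<omega>))"
    by (simp add: distr_distr o_def)
  finally show ?thesis ..
qed

end

section \<open>Weak mixing, uniformly over totally bounded families\<close>

text \<open>
  Along a monotone family the $L^1$ distance is the difference of the means, so it suffices to
  sort the parameters into finitely many bins according to the mean.
\<close>

lemma monotone_family_totally_bounded:
  fixes F :: "real \<Rightarrow> 'a \<Rightarrow> real"
  assumes "prob_space N" and F: "\<And>u. u \<in> U \<Longrightarrow> unit_valued N (F u)"
    and mono: "\<And>u v x. \<lbrakk>u \<in> U; v \<in> U; u \<le> v; x \<in> space N\<rbrakk> \<Longrightarrow> F v x \<le> F u x"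
    and "\<epsilon> > 0"
  shows "\<exists>R. finite R \<and> R \<subseteq> U \<and> (\<forall>u\<in>U. \<exists>r\<in>R. (\<integral>x. \<bar>F u x - F r x\<bar> \<partial>N) \<le> \<epsilon>)"
proof -
  interpret prob_space N by fact
  define \<phi> where "\<phi> u = (\<integral>x. F u x \<partial>N)" for u
  obtain K :: nat where K: "inverse (Suc K) < \<epsilon>" using \<open>\<epsilon> > 0\<close> reals_Archimedean by blast
  define bin where "bin u = \<lfloor>real (Suc K) * \<phi> u\<rfloor>" for u
  \<comment> \<open>The choice is meaningful only for values \<open>b\<close> attained on
    \<open>U\<close>, and \<open>rep\<close> is evaluated only there.\<close>
  define rep where "rep b = (SOME u. u \<in> U \<and> bin u = b)" for b
  have rep: "rep (bin u) \<in> U \<and> bin (rep (bin u)) = bin u" if "u \<in> U" for u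
    unfolding rep_def by (rule someI_ex) (use that in auto)
  have "bin u \<in> {0..int (Suc K)}" if "u \<in> U" for u
  proof -
    have "0 \<le> \<phi> u" "\<phi> u \<le> 1"
      using unit_valued_expectation[OF F[OF that]] by (simp_all add: \<phi>_def)
    then have "0 \<le> real (Suc K) * \<phi> u" "real (Suc K) * \<phi> u \<le> real (Suc K)"
      by (simp_all add: mult_left_le)
    then show ?thesis unfolding bin_def atLeastAtMost_iff by linarith
  qed
  then have "finite (bin ` U)"
    by (meson finite_atLeastAtMost_int finite_subset image_subsetI)
  moreover have "(\<integral>x. \<bar>F u x - F (rep (bin u)) x\<bar> \<partial>N) \<le> \<epsilon>" if u: "u \<in> U" for u
  proof -
    define r where "r = rep (bin u)"
    have r: "r \<in> U" "bin r = bin u" using rep[OF u] by (simp_all add: r_def)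
    have L1: "(\<integral>x. \<bar>F v x - F w x\<bar> \<partial>N) = \<phi> v - \<phi> w" if "v \<in> U" "w \<in> U" "v \<le> w" for v w
    proof -
      have "(\<integral>x. \<bar>F v x - F w x\<bar> \<partial>N) = (\<integral>x. F v x - F w x \<partial>N)"
        using mono[OF that] by (intro Bochner_Integration.integral_cong) auto
      then show ?thesis
        by (simp add: \<phi>_def unit_valued_integrable F that)
    qed
    have "(\<integral>x. \<bar>F u x - F r x\<bar> \<partial>N) \<le> \<bar>\<phi> u - \<phi> r\<bar>"
    proof (cases "u \<le> r")
      case True
      then show ?thesis using L1[OF u r(1)] by simp
    next
      case False
      then show ?thesis using L1[OF r(1) u] by (simp add: abs_minus_commute)
    qed
    also have "\<bar>real (Suc K) * \<phi> u - real (Suc K) * \<phi> r\<bar> < 1"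
      using r(2) unfolding bin_def by linarith
    then have "real (Suc K) * \<bar>\<phi> u - \<phi> r\<bar> < 1"
      unfolding right_diff_distrib[symmetric] abs_mult by simp
    then have "\<bar>\<phi> u - \<phi> r\<bar> \<le> inverse (Suc K)"
      by (simp add: field_simps)
    also note less_imp_le[OF K]
    finally show ?thesis unfolding r_def .
  qed
  ultimately show ?thesis
    using rep by (intro exI[of _ "rep ` bin ` U"]) blast
qed

text \<open>Each row is cut at the diagonal. To its right, diagonal included, gap plus one runs from
  1; to its left it runs from 2; nonnegativity extends both sums to \<open>1..N\<close>. A double
  sum over days thus becomes \<open>N\<close> times a sum over lags, with separate bounds
  \<open>a\<close> and \<open>b\<close> for the two orders of the days.\<close>

lemma sum_square_le_by_gap:
  fixes h :: "nat \<Rightarrow> nat \<Rightarrow> real"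
  assumes up: "\<And>p q. \<lbrakk>1 \<le> p; p \<le> q\<rbrakk> \<Longrightarrow> h p q \<le> a (q - p + 1)"
    and down: "\<And>p q. \<lbrakk>1 \<le> q; q \<le> p\<rbrakk> \<Longrightarrow> h p q \<le> b (p - q + 1)"
    and nonneg: "\<And>l. 0 \<le> a l" "\<And>l. 0 \<le> b l"
  shows "(\<Sum>p=1..N. \<Sum>q=1..N. h p q) \<le> real N * ((\<Sum>l=1..N. a l) + (\<Sum>l=1..N. b l))"
proof -
  have "(\<Sum>q=1..N. h p q) \<le> (\<Sum>l=1..N. a l) + (\<Sum>l=1..N. b l)" if p: "p \<in> {1..N}" for p
  proof -
    have "{1..N} = {1..<p} \<union> {p..N}" using p by auto
    then have "(\<Sum>q=1..N. h p q) = (\<Sum>q=1..<p. h p q) + (\<Sum>q=p..N. h p q)"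
      by (simp only:) (rule sum.union_disjoint, auto)
    also have "(\<Sum>q=p..N. h p q) \<le> (\<Sum>q=p..N. a (q - p + 1))"
      using p by (intro sum_mono up) auto
    also have "\<dots> = (\<Sum>l=1..N-p+1. a l)"
      using p by (intro sum.reindex_bij_witness[of _ "\<lambda>l. l + p - 1" "\<lambda>q. q - p + 1"]) auto
    also have "\<dots> \<le> (\<Sum>l=1..N. a l)"
      using p by (intro sum_mono2 nonneg) auto
    also have "(\<Sum>q=1..<p. h p q) \<le> (\<Sum>q=1..<p. b (p - q + 1))"
      by (intro sum_mono down) auto
    also have "\<dots> = (\<Sum>l=2..p. b l)"
      by (intro sum.reindex_bij_witness[of _ "\<lambda>l. p + 1 - l" "\<lambda>q. p - q + 1"]) auto
    also have "\<dots> \<le> (\<Sum>l=1..N. b l)"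
      using p by (intro sum_mono2 nonneg) auto
    finally show ?thesis by simp
  qed
  then show ?thesis
    using sum_bounded_above[of "{1..N}" "\<lambda>p. \<Sum>q=1..N. h p q"] by simp
qed

text \<open>For \<open>F\<close> with values in [0,1] this is \<open>F\<close> rounded down to a
  multiple of \<open>1 / K\<close>. Writing it as an average of indicators of superlevel sets lets
  weak mixing, a statement about events, act on it by bilinearity of the covariance.\<close>

definition staircase :: "nat \<Rightarrow> ('a \<Rightarrow> real) \<Rightarrow> 'a \<Rightarrow> real" where
  "staircase K F x = 1 / real K * (\<Sum>k=1..K. indicator {x. real k / real K \<le> F x} x)"

lemma staircase_bounds:
  assumes "K \<ge> 1" "0 \<le> F x" "F x \<le> 1"
  shows "\<bar>F x - staircase K F x\<bar> \<le> 1 / K" "0 \<le> staircase K F x" "staircase K F x \<le> 1"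
proof -
  \<comment> \<open>Among the superlevel sets, \<open>x\<close> lies exactly in those with
    \<open>k \<le> m\<close>, so the sum of indicators counts to \<open>m\<close>.\<close>
  define m where "m = nat \<lfloor>K * F x\<rfloor>"
  have Kx: "0 \<le> K * F x" "K * F x \<le> K" using assms by (simp_all add: mult_left_le)
  have iff: "real k / real K \<le> F x \<longleftrightarrow> k \<le> m" for k
    using assms Kx unfolding m_def by (simp add: field_simps le_nat_iff le_floor_iff)
  have m: "m \<le> K" using Kx unfolding m_def by linarith
  have "(\<Sum>k=1..K. indicator {x. real k / real K \<le> F x} x) = (\<Sum>k=1..K. of_bool (k \<le> m) :: real)"
    by (intro sum.cong) (auto simp: iff indicator_def)
  also have "\<dots> = (\<Sum>k=1..m. 1)"
    using m by (intro sum.mono_neutral_cong_right) auto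
  finally have eq: "staircase K F x = m / K" by (simp add: staircase_def)
  show "0 \<le> staircase K F x" "staircase K F x \<le> 1" using m by (auto simp: eq divide_le_eq)
  have "\<bar>K * F x - m\<bar> \<le> 1" using Kx unfolding m_def by linarith
  moreover have "F x - m / K = (K * F x - m) / K" using assms by (simp add: field_simps)
  ultimately show "\<bar>F x - staircase K F x\<bar> \<le> 1 / K"
    unfolding eq using assms by (simp add: divide_right_mono)
qed

section \<open>Covariances along a stationary, weakly mixing process\<close>

locale stationary_mixing =
  fixes P :: "'a measure" and \<nu> :: "real measure" and \<xi> :: "nat \<Rightarrow> 'a \<Rightarrow> real"
  assumes strength_process: "strength_process P \<nu> \<xi>"
begin

sublocale prob_space P
  using strength_process by (simp add: strength_process_def)

lemma measurable_process: "1 \<le> l \<Longrightarrow> \<xi> l \<in> measurable P Rplus"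
  and distr_process: "1 \<le> l \<Longrightarrow> distr P Rplus (\<xi> l) = \<nu>"
  and mixing: "weakly_mixing P \<xi>"
  using strength_process by (simp_all add: strength_process_def)

lemma sets_marginal: "sets \<nu> = sets Rplus"
  using distr_process[of 1] by (metis sets_distr order_refl)

lemma space_marginal: "space \<nu> = {0..}"
  using sets_eq_imp_space_eq[OF sets_marginal] by simp

lemma prob_space_marginal: "prob_space \<nu>"
  using prob_space_distr[OF measurable_process[of 1]] distr_process[of 1] by simp

lemma unit_valued_marginal: "unit_valued \<nu> F \<longleftrightarrow> unit_valued Rplus F"
  by (simp add: unit_valued_def space_marginal measurable_cong_sets[OF sets_marginal refl])

lemma unit_valued_process:
  "unit_valued Rplus F \<Longrightarrow> 1 \<le> l \<Longrightarrow> unit_valued P (\<lambda>\<omega>. F (\<xi> l \<omega>))"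
  by (rule unit_valued_comp[OF _ measurable_process])

lemma expectation_process:
  fixes F :: "real \<Rightarrow> real"
  assumes "F \<in> borel_measurable Rplus" "1 \<le> l"
  shows "expectation (\<lambda>\<omega>. F (\<xi> l \<omega>)) = (\<integral>x. F x \<partial>\<nu>)"
  using integral_distr[OF measurable_process[OF assms(2)] assms(1)] distr_process[OF assms(2)]
  by simp

lemma distr_pair_shift:
  assumes "1 \<le> p" "p \<le> q"
  shows "distr P (Rplus \<Otimes>\<^sub>M Rplus) (\<lambda>\<omega>. (\<xi> p \<omega>, \<xi> q \<omega>)) =
    distr P (Rplus \<Otimes>\<^sub>M Rplus) (\<lambda>\<omega>. (\<xi> 1 \<omega>, \<xi> (q - p + 1) \<omega>))"
\<comment> \<open>Stationarity is assumed for shifts by at least 1, so the shift by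
  \<open>p - 1\<close> needs \<open>p > 1\<close>.\<close>
proof (cases "p = 1")
  case True
  with assms show ?thesis by simp
next
  case False
  with assms have "1 \<le> p - 1" "1 + (p - 1) = p" "q - p + 1 + (p - 1) = q" by auto
  then show ?thesis
    using strength_process[unfolded strength_process_def, THEN conjunct2, THEN conjunct2,
       THEN conjunct1, rule_format, of 1 "q - p + 1" "p - 1"]
    by auto
qed

definition lag_cov :: "(real \<Rightarrow> real) \<Rightarrow> (real \<Rightarrow> real) \<Rightarrow> nat \<Rightarrow> nat \<Rightarrow> real" where
  "lag_cov F G p q = covariance P (\<lambda>\<omega>. F (\<xi> p \<omega>)) (\<lambda>\<omega>. G (\<xi> q \<omega>))"

lemma lag_cov_commute: "lag_cov F G p q = lag_cov G F q p"
  by (simp add: lag_cov_def covariance_def mult.commute)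

text \<open>Stationarity of pairs moves the earlier day to day 1, the reference day of weak mixing.
  Days start at 1, so gap 0 becomes index 1.\<close>

lemma lag_cov_shift:
  assumes [measurable]: "F \<in> borel_measurable Rplus" "G \<in> borel_measurable Rplus"
    and pq: "1 \<le> p" "p \<le> q"
  shows "lag_cov F G p q = lag_cov F G 1 (q - p + 1)"
proof -
  have prod: "expectation (\<lambda>\<omega>. F (\<xi> i \<omega>) * G (\<xi> j \<omega>)) =
      (\<integral>(x, y). F x * G y \<partial>distr P (Rplus \<Otimes>\<^sub>M Rplus) (\<lambda>\<omega>. (\<xi> i \<omega>, \<xi> j \<omega>)))"
    if "1 \<le> i" "1 \<le> j" for i j
    using measurable_process[OF that(1)] measurable_process[OF that(2)]
    by (subst integral_distr) simp_all
  show ?thesis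
    unfolding lag_cov_def covariance_def
    using pq prod[of p q] prod[of 1 "q - p + 1"] distr_pair_shift[OF pq]
    by (simp add: expectation_process)
qed

text \<open>All marginals equal \<open>\<nu>\<close>, so the Lipschitz bound for covariances takes a
  form that does not depend on the days.\<close>

lemma lag_cov_diff_le:
  assumes F: "unit_valued Rplus F" "unit_valued Rplus F'"
    and G: "unit_valued Rplus G" "unit_valued Rplus G'" and pq: "1 \<le> p" "1 \<le> q"
  shows "\<bar>lag_cov F G p q - lag_cov F' G' p q\<bar> \<le>
    (\<integral>x. \<bar>F x - F' x\<bar> \<partial>\<nu>) + (\<integral>x. \<bar>G x - G' x\<bar> \<partial>\<nu>)"
proof -
  note [measurable] = F[THEN unit_valuedD(1)] G[THEN unit_valuedD(1)]
  have "expectation (\<lambda>\<omega>. \<bar>F (\<xi> p \<omega>) - F' (\<xi> p \<omega>)\<bar>) = (\<integral>x. \<bar>F x - F' x\<bar> \<partial>\<nu>)"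
    "expectation (\<lambda>\<omega>. \<bar>G (\<xi> q \<omega>) - G' (\<xi> q \<omega>)\<bar>) = (\<integral>x. \<bar>G x - G' x\<bar> \<partial>\<nu>)"
    using pq by (intro expectation_process; simp)+
  then show ?thesis
    unfolding lag_cov_def
    using covariance_diff_le[OF F[THEN unit_valued_process[OF _ pq(1)]]
      G[THEN unit_valued_process[OF _ pq(2)]]] by simp
qed

text \<open>This is weak mixing for the events that \<open>\<xi> 1\<close> lies in \<open>A\<close>
  and that \<open>\<xi> l\<close> lies in \<open>B\<close>, with the same set \<open>B\<close> for
  all \<open>l\<close>.\<close>

lemma lag_cov_indicator_tendsto:
  assumes A: "A \<in> sets Rplus" and B: "B \<in> sets Rplus"
  shows "(\<lambda>n. (\<Sum>l=1..n. \<bar>lag_cov (indicator A) (indicator B) 1 l\<bar>) / real n) \<longlonglongrightarrow> 0"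
proof -
  define E where "E C l = \<xi> l -` C \<inter> space P" for C :: "real set" and l
  have E: "E C l \<in> sets (vimage_algebra (space P) (\<xi> l) Rplus)" "E C l \<in> sets P"
    if "C \<in> sets Rplus" "1 \<le> l" for C l
    using that in_vimage_algebra measurable_sets[OF measurable_process] by (auto simp: E_def)
  have ind: "expectation (\<lambda>\<omega>. indicat_real C (\<xi> l \<omega>)) = measure P (E C l)"
    if "C \<in> sets Rplus" "1 \<le> l" for C l
  proof -
    have "expectation (\<lambda>\<omega>. indicat_real C (\<xi> l \<omega>)) = expectation (indicator (E C l))"
      by (intro Bochner_Integration.integral_cong) (auto simp: E_def indicator_def)
    then show ?thesis using E(2)[OF that] by simp
  qed
  have eq: "lag_cov (indicator A) (indicator B) 1 l =
      measure P (E A 1 \<inter> E B l) - measure P (E A 1) * measure P (E B l)" if "1 \<le> l" for l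
  proof -
    have "expectation (\<lambda>\<omega>. indicat_real A (\<xi> 1 \<omega>) * indicator B (\<xi> l \<omega>)) =
        expectation (indicator (E A 1 \<inter> E B l))"
      by (intro Bochner_Integration.integral_cong) (auto simp: E_def indicator_def)
    then show ?thesis
      using that A B E(2)[OF A order_refl] E(2)[OF B that]
      by (simp add: lag_cov_def covariance_def ind)
  qed
  have sums: "(\<Sum>l=1..n. \<bar>lag_cov (indicator A) (indicator B) 1 l\<bar>) =
      (\<Sum>l=1..n. \<bar>measure P (E A 1 \<inter> E B l) - measure P (E A 1) * measure P (E B l)\<bar>)" for n
    by (rule sum.cong[OF refl]) (simp only: eq atLeastAtMost_iff)
  have "(\<lambda>n. (\<Sum>l=1..n. \<bar>measure P (E A 1 \<inter> E B l) - measure P (E A 1) * measure P (E B l)\<bar>)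
      / real n) \<longlonglongrightarrow> 0"
    using mixing E(1)[OF A order_refl] E(1)[OF B] unfolding weakly_mixing_def by blast
  then show ?thesis unfolding sums .
qed

text \<open>The absolute values stand inside the sum because the functions will later vary with
  \<open>p\<close> and \<open>q\<close>, so that no cancellation between days can be used.\<close>

definition cov_sum :: "(real \<Rightarrow> real) \<Rightarrow> (real \<Rightarrow> real) \<Rightarrow> nat \<Rightarrow> real" where
  "cov_sum F G N = (\<Sum>p=1..N. \<Sum>q=1..N. \<bar>lag_cov F G p q\<bar>)"

lemma cov_sum_nonneg: "0 \<le> cov_sum F G N"
  by (simp add: cov_sum_def sum_nonneg)

text \<open>Sorting the pairs of days by their gap bounds the quotient by two averages over lags,
  one for each order of the days, and both vanish by weak mixing.\<close>

lemma cov_sum_indicator_tendsto: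
  assumes A: "A \<in> sets Rplus" and B: "B \<in> sets Rplus"
  shows "(\<lambda>N. cov_sum (indicator A) (indicator B) N / (real N)\<^sup>2) \<longlonglongrightarrow> 0"
proof -
  have m: "indicator C \<in> borel_measurable Rplus" if "C \<in> sets Rplus" for C :: "real set"
    using that by simp
  define a where "a l = \<bar>lag_cov (indicator A) (indicator B) 1 l\<bar>" for l
  define b where "b l = \<bar>lag_cov (indicator B) (indicator A) 1 l\<bar>" for l
  have le: "cov_sum (indicator A) (indicator B) N \<le> real N * ((\<Sum>l=1..N. a l) + (\<Sum>l=1..N. b l))" for N
    unfolding cov_sum_def
  proof (rule sum_square_le_by_gap)
    fix p q :: nat
    show "\<bar>lag_cov (indicator A) (indicator B) p q\<bar> \<le> a (q - p + 1)" if "1 \<le> p" "p \<le> q"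
      unfolding a_def using lag_cov_shift[OF m[OF A] m[OF B] that] by simp
    show "\<bar>lag_cov (indicator A) (indicator B) p q\<bar> \<le> b (p - q + 1)" if "1 \<le> q" "q \<le> p"
      unfolding b_def
      using lag_cov_shift[OF m[OF B] m[OF A] that] lag_cov_commute[of "indicator A"] by simp
  qed (simp_all add: a_def b_def)
  have "(\<lambda>N. (\<Sum>l=1..N. a l) / real N + (\<Sum>l=1..N. b l) / real N) \<longlonglongrightarrow> 0 + 0"
    unfolding a_def b_def by (intro tendsto_add lag_cov_indicator_tendsto A B)
  then have lim: "(\<lambda>N. (\<Sum>l=1..N. a l) / real N + (\<Sum>l=1..N. b l) / real N) \<longlonglongrightarrow> 0" by simp
  show ?thesis
  proof (rule tendsto_sandwich[OF _ _ tendsto_const lim])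
    show "\<forall>\<^sub>F N in sequentially. 0 \<le> cov_sum (indicator A) (indicator B) N / (real N)\<^sup>2"
      by (simp add: cov_sum_nonneg)
    show "\<forall>\<^sub>F N in sequentially. cov_sum (indicator A) (indicator B) N / (real N)\<^sup>2 \<le>
        (\<Sum>l=1..N. a l) / real N + (\<Sum>l=1..N. b l) / real N"
      using eventually_gt_at_top[of 0]
    proof eventually_elim
      case (elim N)
      have "cov_sum (indicator A) (indicator B) N / (real N)\<^sup>2 \<le>
          real N * ((\<Sum>l=1..N. a l) + (\<Sum>l=1..N. b l)) / (real N)\<^sup>2"
        using le by (rule divide_right_mono) simp
      then show ?case using elim by (simp add: power2_eq_square add_divide_distrib)
    qed
  qed
qed

text \<open>Replacing both functions by staircases with \<open>L\<close> levels costs at most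
  \<open>2 / L\<close> per pair of days. What remains is bounded by finitely many sums for
  indicators, each of which is negligible.\<close>

lemma cov_sum_tendsto:
  assumes F: "unit_valued Rplus F" and G: "unit_valued Rplus G"
  shows "(\<lambda>N. cov_sum F G N / (real N)\<^sup>2) \<longlonglongrightarrow> 0"
proof (rule tendstoI)
  fix \<epsilon> :: real assume "\<epsilon> > 0"
  obtain K where K: "inverse (real (Suc K)) < \<epsilon> / 4"
    using reals_Archimedean[of "\<epsilon> / 4"] \<open>\<epsilon> > 0\<close> by auto
  define L where "L = Suc K"
  have L: "L \<ge> 1" "1 / real L < \<epsilon> / 4" using K by (simp_all add: L_def inverse_eq_divide)
  \<comment> \<open>Cutting down to nonnegative reals makes these sets measurable in
    \<open>Rplus\<close>; on that space they agree with the level sets of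
    \<open>staircase\<close>.\<close>
  define A where "A H k = {x \<in> {0..}. real k / real L \<le> H x}" for H :: "real \<Rightarrow> real" and k
  have A[measurable]: "A H k \<in> sets Rplus" if "unit_valued Rplus H" for H k
  proof -
    have [measurable]: "H \<in> borel_measurable Rplus" using unit_valuedD(1)[OF that] .
    have "{x \<in> space Rplus. real k / real L \<le> H x} \<in> sets Rplus" by measurable
    then show ?thesis by (simp add: A_def)
  qed
  have stair: "staircase L H x = 1 / real L * (\<Sum>k=1..L. indicator (A H k) x)" if "0 \<le> x" for H x
    using that by (simp add: staircase_def A_def indicator_def)
  have uS: "unit_valued Rplus (staircase L H)"
    and dS: "(\<integral>x. \<bar>H x - staircase L H x\<bar> \<partial>\<nu>) \<le> 1 / real L"
    if H: "unit_valued Rplus H" for H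
  proof -
    have b: "\<bar>H x - staircase L H x\<bar> \<le> 1 / L" "0 \<le> staircase L H x" "staircase L H x \<le> 1"
      if "0 \<le> x" for x
      using staircase_bounds[OF L(1), of H x] unit_valuedD(2,3)[OF H, of x] that by simp_all
    have "staircase L H \<in> borel_measurable Rplus \<longleftrightarrow>
        (\<lambda>x. 1 / real L * (\<Sum>k=1..L. indicator (A H k) x)) \<in> borel_measurable Rplus"
      by (intro measurable_cong stair) simp
    moreover have "(\<lambda>x. 1 / real L * (\<Sum>k=1..L. indicator (A H k) x)) \<in> borel_measurable Rplus"
      using A[OF H] by simp
    ultimately show u: "unit_valued Rplus (staircase L H)"
      using b by (simp add: unit_valued_def)
    interpret nu: prob_space \<nu> by (rule prob_space_marginal)
    have "integrable \<nu> H" "integrable \<nu> (staircase L H)"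
      using u H by (auto intro!: nu.unit_valued_integrable simp: unit_valued_marginal)
    then show "(\<integral>x. \<bar>H x - staircase L H x\<bar> \<partial>\<nu>) \<le> 1 / real L"
      using b by (intro nu.integral_le_const) (auto simp: space_marginal)
  qed
  let ?I = "\<lambda>k l. cov_sum (indicator (A F k)) (indicator (A G l))"
  have lag: "\<bar>lag_cov F G p q\<bar> \<le> 2 / real L +
      (\<Sum>k=1..L. \<Sum>l=1..L. \<bar>lag_cov (indicator (A F k)) (indicator (A G l)) p q\<bar>)"
    if pq: "1 \<le> p" "1 \<le> q" for p q
  proof -
    have nn: "0 \<le> \<xi> i \<omega>" if "1 \<le> i" "\<omega> \<in> space P" for i \<omega>
      using measurable_space[OF measurable_process[OF that(1)] that(2)] by simp
    have "lag_cov (staircase L F) (staircase L G) p q =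
       covariance P (\<lambda>\<omega>. 1 / real L * (\<Sum>k=1..L. indicator (A F k) (\<xi> p \<omega>)))
        (\<lambda>\<omega>. 1 / real L * (\<Sum>k=1..L. indicator (A G k) (\<xi> q \<omega>)))"
      unfolding lag_cov_def covariance_def
      using nn[OF pq(1)] nn[OF pq(2)]
      by (intro arg_cong2[where f="(-)"] arg_cong2[where f="(*)"] Bochner_Integration.integral_cong refl)
        (simp_all add: stair)
    also have "\<dots> = (1 / real L * (1 / real L)) *
       (\<Sum>k=1..L. \<Sum>l=1..L. lag_cov (indicator (A F k)) (indicator (A G l)) p q)"
      unfolding covariance_scale lag_cov_def
      using pq A[OF F] A[OF G]
      by (subst covariance_sum_sum) (auto intro!: unit_valued_process unit_valued_indicator)
    finally have "\<bar>lag_cov (staircase L F) (staircase L G) p q\<bar> = (1 / real L * (1 / real L)) *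
       \<bar>\<Sum>k=1..L. \<Sum>l=1..L. lag_cov (indicator (A F k)) (indicator (A G l)) p q\<bar>"
      by (simp add: abs_mult)
    \<comment> \<open>The factor \<open>1 / L\<close> squared may be wasted, since \<open>L\<close>
      stays fixed while \<open>N\<close> grows.\<close>
    also have "\<dots> \<le> 1 *
       \<bar>\<Sum>k=1..L. \<Sum>l=1..L. lag_cov (indicator (A F k)) (indicator (A G l)) p q\<bar>"
      using L(1) by (intro mult_right_mono mult_le_one) auto
    also have "\<dots> \<le> (\<Sum>k=1..L. \<Sum>l=1..L. \<bar>lag_cov (indicator (A F k)) (indicator (A G l)) p q\<bar>)"
      by (simp, intro order_trans[OF sum_abs] sum_mono sum_abs)
    finally have "\<bar>lag_cov (staircase L F) (staircase L G) p q\<bar> \<le>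
      (\<Sum>k=1..L. \<Sum>l=1..L. \<bar>lag_cov (indicator (A F k)) (indicator (A G l)) p q\<bar>)" .
    moreover have "\<bar>lag_cov F G p q - lag_cov (staircase L F) (staircase L G) p q\<bar> \<le> 1 / L + 1 / L"
      using lag_cov_diff_le[OF F uS[OF F] G uS[OF G] pq] dS[OF F] dS[OF G] by simp
    ultimately show ?thesis by simp
  qed
  have "(\<lambda>N. \<Sum>k=1..L. \<Sum>l=1..L. ?I k l N / (real N)\<^sup>2) \<longlonglongrightarrow> (\<Sum>k=1..L. \<Sum>l=1..L. 0)"
    by (intro tendsto_sum cov_sum_indicator_tendsto A F G)
  then have "(\<lambda>N. \<Sum>k=1..L. \<Sum>l=1..L. ?I k l N / (real N)\<^sup>2) \<longlonglongrightarrow> 0" by simp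
  then have "\<forall>\<^sub>F N in sequentially. (\<Sum>k=1..L. \<Sum>l=1..L. ?I k l N / (real N)\<^sup>2) < \<epsilon> / 2"
    by (rule order_tendstoD) (use \<open>\<epsilon> > 0\<close> in simp)
  then show "\<forall>\<^sub>F N in sequentially. dist (cov_sum F G N / (real N)\<^sup>2) 0 < \<epsilon>"
    using eventually_gt_at_top[of 0]
  proof eventually_elim
    case (elim N)
    have "cov_sum F G N \<le> (\<Sum>p=1..N. \<Sum>q=1..N. 2 / real L +
      (\<Sum>k=1..L. \<Sum>l=1..L. \<bar>lag_cov (indicator (A F k)) (indicator (A G l)) p q\<bar>))"
      unfolding cov_sum_def by (intro sum_mono lag) auto
    also have "\<dots> = (real N)\<^sup>2 * (2 / real L) + (\<Sum>p=1..N. \<Sum>q=1..N.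
      (\<Sum>k=1..L. \<Sum>l=1..L. \<bar>lag_cov (indicator (A F k)) (indicator (A G l)) p q\<bar>))"
      by (simp add: sum.distrib power2_eq_square)
    also have "(\<Sum>p=1..N. \<Sum>q=1..N.
      (\<Sum>k=1..L. \<Sum>l=1..L. \<bar>lag_cov (indicator (A F k)) (indicator (A G l)) p q\<bar>))
      = (\<Sum>k=1..L. \<Sum>l=1..L. ?I k l N)"
      unfolding cov_sum_def
      by (subst sum.swap, subst (2) sum.swap, subst (3) sum.swap, subst (2) sum.swap) (rule refl)
    finally have "cov_sum F G N / (real N)\<^sup>2 \<le>
        ((real N)\<^sup>2 * (2 / real L) + (\<Sum>k=1..L. \<Sum>l=1..L. ?I k l N)) / (real N)\<^sup>2"
      by (rule divide_right_mono) simp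
    also have "\<dots> = 2 / real L + (\<Sum>k=1..L. \<Sum>l=1..L. ?I k l N / (real N)\<^sup>2)"
      using elim by (simp add: add_divide_distrib sum_divide_distrib)
    also have "\<dots> < \<epsilon>" using L elim by simp
    finally show ?case by (simp add: cov_sum_nonneg)
  qed
qed

text \<open>Each function is replaced by a nearby one from a finite set \<open>R\<close>. The
  threshold for \<open>N\<close> then depends only on the finitely many pairs from \<open>R\<close>,
  so it serves all choices of \<open>u\<close> at once, even choices that change with
  \<open>N\<close>.\<close>

lemma lag_cov_uniform:
  fixes F :: "'i \<Rightarrow> real \<Rightarrow> real"
  assumes F: "\<And>u. u \<in> U \<Longrightarrow> unit_valued Rplus (F u)"
    and tb: "\<And>\<epsilon>. \<epsilon> > 0 \<Longrightarrow>
      \<exists>R. finite R \<and> R \<subseteq> U \<and> (\<forall>u\<in>U. \<exists>r\<in>R. (\<integral>x. \<bar>F u x - F r x\<bar> \<partial>\<nu>) \<le> \<epsilon>)"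
    and "\<epsilon> > 0"
  shows "\<forall>\<^sub>F N in sequentially. \<forall>u. (\<forall>p\<in>{1..N}. u p \<in> U) \<longrightarrow>
    (\<Sum>p=1..N. \<Sum>q=1..N. \<bar>lag_cov (F (u p)) (F (u q)) p q\<bar>) \<le> \<epsilon> * (real N)\<^sup>2"
proof -
  obtain R where R: "finite R" "R \<subseteq> U"
    and app: "\<And>u. u \<in> U \<Longrightarrow> \<exists>r\<in>R. (\<integral>x. \<bar>F u x - F r x\<bar> \<partial>\<nu>) \<le> \<epsilon> / 4"
    using tb[of "\<epsilon> / 4"] \<open>\<epsilon> > 0\<close> by auto
  have lag: "\<bar>lag_cov (F u) (F v) p q\<bar> \<le> \<epsilon> / 2 + (\<Sum>r\<in>R. \<Sum>t\<in>R. \<bar>lag_cov (F r) (F t) p q\<bar>)"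
    if "u \<in> U" "v \<in> U" "1 \<le> p" "1 \<le> q" for u v p q
  proof -
    obtain r where r: "r \<in> R" "(\<integral>x. \<bar>F u x - F r x\<bar> \<partial>\<nu>) \<le> \<epsilon> / 4" using app \<open>u \<in> U\<close> by auto
    obtain t where t: "t \<in> R" "(\<integral>x. \<bar>F v x - F t x\<bar> \<partial>\<nu>) \<le> \<epsilon> / 4" using app \<open>v \<in> U\<close> by auto
    have "\<bar>lag_cov (F u) (F v) p q - lag_cov (F r) (F t) p q\<bar> \<le> \<epsilon> / 4 + \<epsilon> / 4"
      using lag_cov_diff_le[of "F u" "F r" "F v" "F t" p q] F r t R(2) that by fastforce
    \<comment> \<open>The representatives vary with the parameters, hence later with the days;
      summing over all pairs from \<open>R\<close> removes this dependence.\<close>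
    moreover have "\<bar>lag_cov (F r) (F t) p q\<bar> \<le> (\<Sum>t\<in>R. \<bar>lag_cov (F r) (F t) p q\<bar>)"
      using R t by (intro member_le_sum) auto
    moreover have "(\<Sum>t\<in>R. \<bar>lag_cov (F r) (F t) p q\<bar>) \<le> (\<Sum>r\<in>R. \<Sum>t\<in>R. \<bar>lag_cov (F r) (F t) p q\<bar>)"
      using R r by (intro member_le_sum[of r R "\<lambda>r. \<Sum>t\<in>R. \<bar>lag_cov (F r) (F t) p q\<bar>"])
        (auto intro: sum_nonneg)
    ultimately show ?thesis by linarith
  qed
  have "(\<lambda>N. \<Sum>r\<in>R. \<Sum>t\<in>R. cov_sum (F r) (F t) N / (real N)\<^sup>2) \<longlonglongrightarrow> (\<Sum>r\<in>R. \<Sum>t\<in>R. 0)"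
    using R by (intro tendsto_sum cov_sum_tendsto F) auto
  then have "(\<lambda>N. \<Sum>r\<in>R. \<Sum>t\<in>R. cov_sum (F r) (F t) N / (real N)\<^sup>2) \<longlonglongrightarrow> 0" by simp
  then have "\<forall>\<^sub>F N in sequentially. (\<Sum>r\<in>R. \<Sum>t\<in>R. cov_sum (F r) (F t) N / (real N)\<^sup>2) < \<epsilon> / 2"
    by (rule order_tendstoD) (use \<open>\<epsilon> > 0\<close> in simp)
  then show ?thesis
    using eventually_gt_at_top[of 0]
  proof eventually_elim
    case (elim N)
    have "(\<Sum>p=1..N. \<Sum>q=1..N. \<bar>lag_cov (F (u p)) (F (u q)) p q\<bar>) \<le> \<epsilon> * (real N)\<^sup>2"
      if u: "\<forall>p\<in>{1..N}. u p \<in> U" for u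
    proof -
      have "(\<Sum>p=1..N. \<Sum>q=1..N. \<bar>lag_cov (F (u p)) (F (u q)) p q\<bar>) \<le>
          (\<Sum>p=1..N. \<Sum>q=1..N. \<epsilon> / 2 + (\<Sum>r\<in>R. \<Sum>t\<in>R. \<bar>lag_cov (F r) (F t) p q\<bar>))"
        using u by (intro sum_mono lag) auto
      also have "\<dots> = (real N)\<^sup>2 * (\<epsilon> / 2) +
          (\<Sum>p=1..N. \<Sum>q=1..N. \<Sum>r\<in>R. \<Sum>t\<in>R. \<bar>lag_cov (F r) (F t) p q\<bar>)"
        by (simp add: sum.distrib power2_eq_square)
      also have "(\<Sum>p=1..N. \<Sum>q=1..N. \<Sum>r\<in>R. \<Sum>t\<in>R. \<bar>lag_cov (F r) (F t) p q\<bar>) =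
          (\<Sum>r\<in>R. \<Sum>t\<in>R. cov_sum (F r) (F t) N)"
        unfolding cov_sum_def
        by (subst sum.swap, subst (2) sum.swap, subst (3) sum.swap, subst (2) sum.swap) (rule refl)
      also have "\<dots> = (real N)\<^sup>2 * (\<Sum>r\<in>R. \<Sum>t\<in>R. cov_sum (F r) (F t) N / (real N)\<^sup>2)"
        using elim by (simp add: sum_divide_distrib[symmetric])
      also have "\<dots> \<le> (real N)\<^sup>2 * (\<epsilon> / 2)"
        using elim by (intro mult_left_mono) auto
      finally show ?thesis by (simp add: mult.commute)
    qed
    then show ?case by blast
  qed
qed

end

section \<open>The expected result of one match\<close>

lemma integral_pair_unit_valued:
  assumes "prob_space A" "prob_space B" and h: "unit_valued (A \<Otimes>\<^sub>M B) (case_prod h)"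
  shows "unit_valued A (\<lambda>x. \<integral>y. h x y \<partial>B)" "unit_valued B (\<lambda>y. \<integral>x. h x y \<partial>A)"
    and "(\<integral>(x, y). h x y \<partial>(A \<Otimes>\<^sub>M B)) = (\<integral>x. \<integral>y. h x y \<partial>B \<partial>A)"
    and "(\<integral>(x, y). h x y \<partial>(A \<Otimes>\<^sub>M B)) = (\<integral>y. \<integral>x. h x y \<partial>A \<partial>B)"
proof -
  interpret A: prob_space A by fact
  interpret B: prob_space B by fact
  interpret AB: pair_prob_space A B ..
  have [measurable]: "case_prod h \<in> borel_measurable (A \<Otimes>\<^sub>M B)" using unit_valuedD(1)[OF h] .
  have int: "integrable (A \<Otimes>\<^sub>M B) (case_prod h)" by (rule AB.unit_valued_integrable[OF h])
  have "unit_valued B (\<lambda>y. h x y)" if "x \<in> space A" for x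
    using unit_valued_comp[OF h, of "\<lambda>y. (x, y)" B] that by simp
  then show "unit_valued A (\<lambda>x. \<integral>y. h x y \<partial>B)"
    using B.unit_valued_expectation by (simp add: unit_valued_def[of A])
  have "unit_valued A (\<lambda>x. h x y)" if "y \<in> space B" for y
    using unit_valued_comp[OF h, of "\<lambda>x. (x, y)" A] that by simp
  then show "unit_valued B (\<lambda>y. \<integral>x. h x y \<partial>A)"
    using A.unit_valued_expectation by (simp add: unit_valued_def[of B])
  show "(\<integral>(x, y). h x y \<partial>(A \<Otimes>\<^sub>M B)) = (\<integral>x. \<integral>y. h x y \<partial>B \<partial>A)"
    using AB.integral_fst[OF int] by simp
  show "(\<integral>(x, y). h x y \<partial>(A \<Otimes>\<^sub>M B)) = (\<integral>y. \<integral>x. h x y \<partial>A \<partial>B)"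
    using AB.integral_snd[OF int] by simp
qed

lemma (in prob_space) indep_pair_expectation:
  assumes ind: "indep_vars (\<lambda>_. S) Y I" and ij: "i \<in> I" "j \<in> I" "i \<noteq> j"
    and g: "unit_valued (S \<Otimes>\<^sub>M S) (case_prod g)"
  shows "expectation (\<lambda>\<omega>. g (Y i \<omega>) (Y j \<omega>)) =
    (\<integral>x. \<integral>y. g x y \<partial>distr M S (Y j) \<partial>distr M S (Y i))"
proof -
  have [measurable]: "random_variable S (Y i)" "random_variable S (Y j)"
    using ind ij by (auto simp: indep_vars_def)
  note [measurable] = unit_valuedD(1)[OF g]
  have "expectation (\<lambda>\<omega>. g (Y i \<omega>) (Y j \<omega>)) =
      (\<integral>(x, y). g x y \<partial>distr M (S \<Otimes>\<^sub>M S) (\<lambda>\<omega>. (Y i \<omega>, Y j \<omega>)))"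
    by (subst integral_distr) simp_all
  also have "\<dots> = (\<integral>(x, y). g x y \<partial>(distr M S (Y i) \<Otimes>\<^sub>M distr M S (Y j)))"
    using indep_vars_pair_distr[OF ind ij] by simp
  also have "\<dots> = (\<integral>x. \<integral>y. g x y \<partial>distr M S (Y j) \<partial>distr M S (Y i))"
    using g by (intro integral_pair_unit_valued(3) prob_space_distr)
      (simp_all add: unit_valued_def space_pair_measure)
  finally show ?thesis .
qed

text \<open>Given the shared variable \<open>Y i\<close>, the other two are independent, so the
  inner integral factors. It is meant for team 0 facing two different opponents.\<close>

lemma (in prob_space) indep_triple_expectation:
  assumes ind: "indep_vars (\<lambda>_. S) Y I"
    and ijk: "i \<in> I" "j \<in> I" "k \<in> I" "i \<noteq> j" "i \<noteq> k" "j \<noteq> k"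
    and g: "unit_valued (S \<Otimes>\<^sub>M S) (case_prod g)" and h: "unit_valued (S \<Otimes>\<^sub>M S) (case_prod h)"
  shows "expectation (\<lambda>\<omega>. g (Y i \<omega>) (Y j \<omega>) * h (Y i \<omega>) (Y k \<omega>)) =
    (\<integral>x. (\<integral>y. g x y \<partial>distr M S (Y j)) * (\<integral>z. h x z \<partial>distr M S (Y k)) \<partial>distr M S (Y i))"
proof -
  have [measurable]: "random_variable S (Y i)" "random_variable S (Y j)" "random_variable S (Y k)"
    using ind ijk by (auto simp: indep_vars_def)
  note [measurable] = unit_valuedD(1)[OF g] unit_valuedD(1)[OF h]
  let ?D = "\<lambda>i. distr M S (Y i)"
  have D: "prob_space (?D i)" "prob_space (?D j)" "prob_space (?D k)"
    by (auto intro: prob_space_distr)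
  have D2: "prob_space (?D j \<Otimes>\<^sub>M ?D k)" using D by (intro prob_space_pair)
  have prod: "unit_valued (?D i \<Otimes>\<^sub>M (?D j \<Otimes>\<^sub>M ?D k)) (\<lambda>(x, y, z). g x y * h x z)"
    using g h by (auto simp: unit_valued_def space_pair_measure intro!: mult_le_one)
  have "expectation (\<lambda>\<omega>. g (Y i \<omega>) (Y j \<omega>) * h (Y i \<omega>) (Y k \<omega>)) =
      (\<integral>(x, y, z). g x y * h x z
        \<partial>distr M (S \<Otimes>\<^sub>M S \<Otimes>\<^sub>M S) (\<lambda>\<omega>. (Y i \<omega>, Y j \<omega>, Y k \<omega>)))"
    by (subst integral_distr) simp_all
  also have "\<dots> = (\<integral>(x, y, z). g x y * h x z \<partial>(?D i \<Otimes>\<^sub>M (?D j \<Otimes>\<^sub>M ?D k)))"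
    using indep_vars_triple_distr[OF ind ijk] by simp
  also have "\<dots> = (\<integral>x. \<integral>(y, z). g x y * h x z \<partial>(?D j \<Otimes>\<^sub>M ?D k) \<partial>?D i)"
    using prod by (intro integral_pair_unit_valued(3) D D2)
  also have "\<dots> = (\<integral>x. (\<integral>y. g x y \<partial>?D j) * (\<integral>z. h x z \<partial>?D k) \<partial>?D i)"
  proof (rule Bochner_Integration.integral_cong[OF refl])
    fix x assume "x \<in> space (?D i)"
    then have "x \<in> space S" by simp
    then have "unit_valued (?D j \<Otimes>\<^sub>M ?D k) (\<lambda>(y, z). g x y * h x z)"
      using g h by (auto simp: unit_valued_def space_pair_measure intro!: mult_le_one)
    then have "(\<integral>(y, z). g x y * h x z \<partial>(?D j \<Otimes>\<^sub>M ?D k)) = (\<integral>y. \<integral>z. g x y * h x z \<partial>?D k \<partial>?D j)"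
      by (intro integral_pair_unit_valued(3) D)
    then show "(\<integral>(y, z). g x y * h x z \<partial>(?D j \<Otimes>\<^sub>M ?D k)) = (\<integral>y. g x y \<partial>?D j) * (\<integral>z. h x z \<partial>?D k)"
      by simp
  qed
  finally show ?thesis .
qed

lemma measurable_times_Rplus:
  assumes [measurable]: "X \<in> measurable M Rplus" "Y \<in> measurable M Rplus"
  shows "(\<lambda>\<omega>. X \<omega> * Y \<omega>) \<in> measurable M Rplus"
proof (rule measurable_restrict_space2)
  show "(\<lambda>\<omega>. X \<omega> * Y \<omega>) \<in> space M \<rightarrow> {0..}"
    using measurable_space[OF assms(1)] measurable_space[OF assms(2)] by auto
  have "X \<in> borel_measurable M" "Y \<in> borel_measurable M"
    using assms by (auto simp: measurable_restrict_space2_iff)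
  then show "(\<lambda>\<omega>. X \<omega> * Y \<omega>) \<in> borel_measurable M" by simp
qed

lemma win_function_unit_valued:
  assumes f: "win_function f" and X: "X \<in> measurable M Rplus" and Y: "Y \<in> measurable M Rplus"
  shows "unit_valued M (\<lambda>\<omega>. f (X \<omega>) (Y \<omega>))"
proof -
  have "unit_valued (Rplus \<Otimes>\<^sub>M Rplus) (\<lambda>(x, y). f x y)"
    using f by (auto simp: unit_valued_def win_function_def space_pair_measure)
  from unit_valued_comp[OF this measurable_Pair[OF X Y]] show ?thesis by simp
qed

section \<open>Winning probabilities as functions of the initial strengths\<close>

definition win_prob :: "(real \<Rightarrow> real \<Rightarrow> real) \<Rightarrow> real measure \<Rightarrow> real \<Rightarrow> real \<Rightarrow> real \<Rightarrow> real" where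
  "win_prob f \<nu> s u x = (\<integral>v. f (s * x) (u * v) \<partial>\<nu>)"

definition mean_win_prob :: "(real \<Rightarrow> real \<Rightarrow> real) \<Rightarrow> real measure \<Rightarrow> real \<Rightarrow> real \<Rightarrow> real" where
  "mean_win_prob f \<nu> s u = (\<integral>x. win_prob f \<nu> s u x \<partial>\<nu>)"

lemma unit_valued_win_prob:
  assumes f: "win_function f" and \<nu>: "borel_prob_Rplus \<nu>" and "0 \<le> s" "0 \<le> u"
  shows "unit_valued \<nu> (win_prob f \<nu> s u)"
proof -
  have sets[measurable_cong]: "sets \<nu> = sets Rplus" and p: "prob_space \<nu>"
    using \<nu> by (auto simp: borel_prob_Rplus_def)
  have "unit_valued (\<nu> \<Otimes>\<^sub>M \<nu>) (\<lambda>(x, v). f (s * x) (u * v))"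
    unfolding case_prod_beta using assms(3,4)
    by (intro win_function_unit_valued[OF f] measurable_times_Rplus) simp_all
  from integral_pair_unit_valued(1)[OF p p this] show ?thesis
    by (simp add: win_prob_def[abs_def])
qed

text \<open>A stronger opponent is stronger for every nonnegative value of its daily factor, and
  \<open>f\<close> decreases in its second argument. This provides the monotone family required for
  total boundedness.\<close>

lemma win_prob_antimono:
  assumes f: "win_function f" and \<nu>: "borel_prob_Rplus \<nu>"
    and nonneg: "0 \<le> s" "0 \<le> u" "0 \<le> x" and uv: "u \<le> v"
  shows "win_prob f \<nu> s v x \<le> win_prob f \<nu> s u x"
proof -
  have sets[measurable_cong]: "sets \<nu> = sets Rplus" and p: "prob_space \<nu>"
    using \<nu> by (auto simp: borel_prob_Rplus_def)
  interpret prob_space \<nu> by fact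
  have sp: "space \<nu> = {0..}" using sets_eq_imp_space_eq[OF sets] by simp
  have "unit_valued \<nu> (\<lambda>w. f (s * x) (t * w))" if "0 \<le> t" for t
    using nonneg that by (intro win_function_unit_valued[OF f] measurable_times_Rplus) simp_all
  moreover have "f (s * x) (v * w) \<le> f (s * x) (u * w)" if "0 \<le> w" for w
  proof -
    have "u * w \<le> v * w" using that uv by (rule mult_right_mono[rotated])
    then show ?thesis using f nonneg that unfolding win_function_def by simp
  qed
  ultimately show ?thesis
    unfolding win_prob_def using nonneg uv
    by (intro integral_mono unit_valued_integrable) (simp_all add: sp)
qed

text \<open>Fubini's theorem, integrating first the opponent's daily factor, then team 0's own, and
  last the opponent's initial strength. The result is the limit that the strong law
  provides.\<close>

lemma limit_wins_eq:
  assumes f: "win_function f" and \<mu>: "borel_prob_Rplus \<mu>" and \<nu>: "borel_prob_Rplus \<nu>" and s: "0 \<le> s"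
  shows "unit_valued \<mu> (mean_win_prob f \<nu> s)"
    and "limit_wins f \<mu> \<nu> s = (\<integral>u. mean_win_prob f \<nu> s u \<partial>\<mu>)"
proof -
  have sets[measurable_cong]: "sets \<nu> = sets Rplus" "sets \<mu> = sets Rplus"
    and p: "prob_space \<nu>" "prob_space \<mu>"
    using \<mu> \<nu> by (auto simp: borel_prob_Rplus_def)
  interpret pair_prob_space \<nu> \<mu>
    using p by (simp add: pair_prob_space_def pair_sigma_finite_def prob_space_imp_sigma_finite)
  have 1: "unit_valued (\<nu> \<Otimes>\<^sub>M (\<nu> \<Otimes>\<^sub>M \<mu>)) (\<lambda>(x, v, u). f (s * x) (u * v))"
    unfolding case_prod_beta using s
    by (intro win_function_unit_valued[OF f] measurable_times_Rplus) simp_all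
  have 2: "unit_valued (\<nu> \<Otimes>\<^sub>M \<mu>) (\<lambda>(v, u). f (s * x) (u * v))" if "x \<in> space \<nu>" for x
    unfolding case_prod_beta using s that sets_eq_imp_space_eq[OF sets(1)]
    by (intro win_function_unit_valued[OF f] measurable_times_Rplus) simp_all
  \<comment> \<open>Grouping team 0's factor with the opponent's strength makes
    \<open>win_prob\<close> jointly measurable in both after the remaining variable is integrated
    out.\<close>
  have 3: "unit_valued ((\<nu> \<Otimes>\<^sub>M \<mu>) \<Otimes>\<^sub>M \<nu>) (\<lambda>(y, v). f (s * fst y) (snd y * v))"
    unfolding case_prod_beta using s
    by (intro win_function_unit_valued[OF f] measurable_times_Rplus) simp_all
  have 4: "unit_valued (\<nu> \<Otimes>\<^sub>M \<mu>) (\<lambda>(x, u). win_prob f \<nu> s u x)"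
    using integral_pair_unit_valued(1)[OF prob_space_axioms p(1) 3]
    by (simp add: win_prob_def split_beta')
  show "unit_valued \<mu> (mean_win_prob f \<nu> s)"
    using integral_pair_unit_valued(2)[OF p 4] by (simp add: mean_win_prob_def[abs_def])
  have "limit_wins f \<mu> \<nu> s = (\<integral>x. \<integral>(v, u). f (s * x) (u * v) \<partial>(\<nu> \<Otimes>\<^sub>M \<mu>) \<partial>\<nu>)"
    unfolding limit_wins_def
    using integral_pair_unit_valued(3)[OF p(1) prob_space_axioms 1] .
  also have "\<dots> = (\<integral>x. \<integral>u. win_prob f \<nu> s u x \<partial>\<mu> \<partial>\<nu>)"
    unfolding win_prob_def
    using integral_pair_unit_valued(4)[OF p 2] by (intro Bochner_Integration.integral_cong refl)
  also have "\<dots> = (\<integral>u. mean_win_prob f \<nu> s u \<partial>\<mu>)"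
    unfolding mean_win_prob_def
    using integral_pair_unit_valued(3)[OF p 4] integral_pair_unit_valued(4)[OF p 4] by simp
  finally show "limit_wins f \<mu> \<nu> s = (\<integral>u. mean_win_prob f \<nu> s u \<partial>\<mu>)" .
qed

text \<open>Independence makes the joint law of \<open>(V, V', U)\<close> the product measure, and a
  change of variables gives the expectation.\<close>

lemma limit_wins_indep:
  assumes f: "win_function f" and s: "0 \<le> s" and "prob_space Q"
    and ind: "prob_space.indep_vars Q (\<lambda>_. Rplus) (\<lambda>k. [V, V', U] ! k) {..<3::nat}"
    and D: "distr Q Rplus V = \<nu>" "distr Q Rplus V' = \<nu>" "distr Q Rplus U = \<mu>"
  shows "limit_wins f \<mu> \<nu> s = (\<integral>\<omega>. f (s * V \<omega>) (U \<omega> * V' \<omega>) \<partial>Q)"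
proof -
  interpret prob_space Q by fact
  have rv: "random_variable Rplus ([V, V', U] ! k)" if "k < 3" for k
    using ind that by (simp add: indep_vars_def)
  have [measurable]: "V \<in> measurable Q Rplus" "V' \<in> measurable Q Rplus" "U \<in> measurable Q Rplus"
    using rv[of 0] rv[of 1] rv[of 2] by simp_all
  have "distr Q (Rplus \<Otimes>\<^sub>M Rplus \<Otimes>\<^sub>M Rplus) (\<lambda>\<omega>. (V \<omega>, V' \<omega>, U \<omega>)) = \<nu> \<Otimes>\<^sub>M \<nu> \<Otimes>\<^sub>M \<mu>"
    using indep_vars_triple_distr[OF ind, of 0 1 2] D by simp
  moreover have "unit_valued (Rplus \<Otimes>\<^sub>M (Rplus \<Otimes>\<^sub>M Rplus)) (\<lambda>(x, v, u). f (s * x) (u * v))"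
    unfolding case_prod_beta using s
    by (intro win_function_unit_valued[OF f] measurable_times_Rplus) simp_all
  note [measurable] = unit_valuedD(1)[OF this]
  ultimately show ?thesis
    unfolding limit_wins_def by (subst (asm) eq_commute) (simp add: integral_distr)
qed

section \<open>Mean and variance of the number of wins\<close>

lemma measurable_path:
  "(\<And>p. 1 \<le> p \<Longrightarrow> X p \<in> measurable M Rplus) \<Longrightarrow> path X \<in> measurable M path_space"
  unfolding path_def[abs_def] by (rule measurable_restrict) simp

lemma path_apply: "1 \<le> p \<Longrightarrow> path X \<omega> p = X p \<omega>"
  by (simp add: path_def)

lemma measurable_path_component: "1 \<le> p \<Longrightarrow> (\<lambda>x. x p) \<in> measurable path_space Rplus"
  by (rule measurable_component_singleton) simp

section \<open>A league of fixed size with deterministic initial strengths\<close>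

locale league_model = stationary_mixing P \<nu> \<xi>
  for P :: "'a measure" and \<nu> \<xi> +
  fixes n :: nat and opp :: "nat \<Rightarrow> nat \<Rightarrow> nat" and f :: "real \<Rightarrow> real \<Rightarrow> real"
    and a :: "nat \<Rightarrow> real" and M :: "'b measure" and X :: "nat \<Rightarrow> nat \<Rightarrow> 'b \<Rightarrow> real"
    and won :: "nat \<Rightarrow> nat \<Rightarrow> 'b \<Rightarrow> bool"
  assumes n: "1 \<le> n"
    and cal: "calendar n opp"
    and win_function: "win_function f"
    and a_nonneg: "\<And>i. i < 2 * n \<Longrightarrow> 0 \<le> a i"
    and league: "league n opp f a P \<xi> M X won"
begin

sublocale M: prob_space M
  using league by (simp add: league_def)

lemma borel_prob: "borel_prob_Rplus \<nu>"
  by (simp add: borel_prob_Rplus_def prob_space_marginal sets_marginal)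

lemma indep_paths: "M.indep_vars (\<lambda>_. path_space) (\<lambda>i. path (X i)) {..<2*n}"
  and distr_path: "i < 2 * n \<Longrightarrow> distr M path_space (path (X i)) = distr P path_space (path \<xi>)"
  and won_sets: "i < 2 * n \<Longrightarrow> p \<in> {1..2*n-1} \<Longrightarrow> {\<omega>\<in>space M. won i p \<omega>} \<in> sets M"
  and cond_exp: "J \<subseteq> matches n opp \<Longrightarrow> AE \<omega> in M.
        real_cond_exp M (strength_algebra n a M X)
          (indicator {\<omega>\<in>space M. \<forall>(i, p)\<in>J. won i p \<omega>}) \<omega> =
        (\<Prod>(i, p)\<in>J. f (strength a X i p \<omega>) (strength a X (opp p i) p \<omega>))"
  using league by (simp_all add: league_def)

lemma measurable_X:
  assumes "i < 2 * n" "1 \<le> p"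
  shows "X i p \<in> measurable M Rplus"
proof -
  have "path (X i) \<in> measurable M path_space"
    using indep_paths assms by (simp add: M.indep_vars_def)
  from measurable_compose[OF this measurable_path_component[OF assms(2)]]
  show ?thesis using assms by (simp add: path_apply)
qed

lemma measurable_strength:
  assumes "i < 2 * n" "1 \<le> p"
  shows "strength a X i p \<in> measurable M Rplus"
  unfolding strength_def[abs_def]
  using measurable_X[OF assms] a_nonneg[OF assms(1)]
  by (intro measurable_times_Rplus) simp_all

lemma opp_lt: "p \<in> {1..2*n-1} \<Longrightarrow> i < 2 * n \<Longrightarrow> opp p i < 2 * n"
  and opp_neq: "p \<in> {1..2*n-1} \<Longrightarrow> i < 2 * n \<Longrightarrow> opp p i \<noteq> i"
  using cal by (simp_all add: calendar_def)

text \<open>Team 0 meets each other team on exactly one day. The bijection turns sums over days into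
  sums over opponents, and its injectivity makes opponents on different days different.\<close>

lemma opp_0_bij: "bij_betw (\<lambda>p. opp p 0) {1..2*n-1} {1..2*n-1}"
proof -
  have ex1: "\<exists>!p. p \<in> {1..2*n-1} \<and> opp p 0 = j" if "0 < j" "j < 2 * n" for j
    using cal that n by (simp add: calendar_def)
  have in_range: "opp p 0 \<in> {1..2*n-1}" if "p \<in> {1..2*n-1}" for p
    using opp_lt[OF that, of 0] opp_neq[OF that, of 0] n by auto
  have "inj_on (\<lambda>p. opp p 0) {1..2*n-1}"
  proof (rule inj_onI)
    fix p q assume pq: "p \<in> {1..2*n-1}" "q \<in> {1..2*n-1}" "opp p 0 = opp q 0"
    have "\<exists>!r. r \<in> {1..2*n-1} \<and> opp r 0 = opp p 0"
      using in_range[OF pq(1)] by (intro ex1) auto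
    then show "p = q" using pq by auto
  qed
  moreover have "{1..2*n-1} \<subseteq> (\<lambda>p. opp p 0) ` {1..2*n-1}"
  proof
    fix j assume "j \<in> {1..2*n-1}"
    then have "\<exists>!p. p \<in> {1..2*n-1} \<and> opp p 0 = j" by (intro ex1) auto
    then show "j \<in> (\<lambda>p. opp p 0) ` {1..2*n-1}" by blast
  qed
  ultimately show ?thesis
    using in_range unfolding bij_betw_def by blast
qed

lemma opp_0_range: "p \<in> {1..2*n-1} \<Longrightarrow> opp p 0 \<in> {1..2*n-1}"
  using opp_0_bij by (rule bij_betwE[THEN bspec])

text \<open>The conditional law of the results is averaged over the strengths: a conditional
  expectation has the same mean as the variable itself.\<close>

lemma prob_results:
  assumes J: "J \<subseteq> matches n opp"
  shows "M.prob {\<omega>\<in>space M. \<forall>(i, p)\<in>J. won i p \<omega>} =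
    M.expectation (\<lambda>\<omega>. \<Prod>(i, p)\<in>J. f (strength a X i p \<omega>) (strength a X (opp p i) p \<omega>))"
proof -
  let ?F = "strength_algebra n a M X" and ?E = "{\<omega>\<in>space M. \<forall>(i, p)\<in>J. won i p \<omega>}"
  have "matches n opp \<subseteq> {..<2*n} \<times> {1..2*n-1}" by (auto simp: matches_def)
  with J have fin: "finite J" and J': "\<And>i p. (i, p) \<in> J \<Longrightarrow> i < 2 * n \<and> p \<in> {1..2*n-1}"
    by (meson finite_SigmaI finite_atLeastAtMost finite_lessThan finite_subset) (use J in \<open>auto simp: matches_def\<close>)
  have E[measurable]: "?E \<in> sets M"
    using fin J' by (intro sets.sets_Collect_finite_All) (auto intro: won_sets)
  have "(\<lambda>\<omega>. \<lambda>(i, p)\<in>{..<2*n} \<times> {1..2*n-1}. strength a X i p \<omega>)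
      \<in> measurable M (PiM ({..<2*n} \<times> {1..2*n-1}) (\<lambda>_. Rplus))"
    using measurable_strength by (intro measurable_restrict) auto
  \<comment> \<open>Measurability of all strengths places the conditioning algebra inside the events
    of \<open>M\<close>, as conditional expectations require.\<close>
  then have "subalgebra M ?F"
    unfolding strength_algebra_def subalgebra_def measurable_iff_sets by simp
  then interpret F: finite_measure_subalgebra M ?F
    by unfold_locales
  have m: "(\<lambda>\<omega>. \<Prod>(i, p)\<in>J. f (strength a X i p \<omega>) (strength a X (opp p i) p \<omega>))
      \<in> borel_measurable M"
  proof (rule borel_measurable_prod)
    fix z assume "z \<in> J"
    then obtain i p where z: "z = (i, p)" "i < 2 * n" "p \<in> {1..2*n-1}" using J' by (cases z) auto
    then have "unit_valued M (\<lambda>\<omega>. f (strength a X i p \<omega>) (strength a X (opp p i) p \<omega>))"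
      by (intro win_function_unit_valued[OF win_function] measurable_strength opp_lt) auto
    then show "(\<lambda>\<omega>. case z of (i, p) \<Rightarrow> f (strength a X i p \<omega>) (strength a X (opp p i) p \<omega>))
        \<in> borel_measurable M"
      using z by (simp add: unit_valuedD)
  qed
  have "M.prob ?E = M.expectation (indicator ?E)" by simp
  also have "\<dots> = M.expectation (real_cond_exp M ?F (indicator ?E))"
    by (rule F.real_cond_exp_int(2)[symmetric]) (simp add: M.emeasure_eq_measure)
  also have "\<dots> = M.expectation (\<lambda>\<omega>. \<Prod>(i, p)\<in>J. f (strength a X i p \<omega>) (strength a X (opp p i) p \<omega>))"
    using cond_exp[OF J] m by (intro integral_cong_AE) auto
  finally show ?thesis .
qed

lemma integral_path_law:
  fixes h :: "real \<Rightarrow> real"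
  assumes h: "h \<in> borel_measurable Rplus" and p: "1 \<le> p"
  shows "(\<integral>x. h (x p) \<partial>distr P path_space (path \<xi>)) = (\<integral>x. h x \<partial>\<nu>)"
proof -
  have "(\<integral>x. h (x p) \<partial>distr P path_space (path \<xi>)) = expectation (\<lambda>\<omega>. h (path \<xi> \<omega> p))"
    by (intro integral_distr measurable_path measurable_process
       measurable_compose[OF measurable_path_component h] p)
  then show ?thesis using p expectation_process[OF h p] by (simp add: path_apply)
qed

lemma integral_opponent_path:
  assumes "0 \<le> u" "0 \<le> c" "1 \<le> p"
  shows "(\<integral>y. f c (u * y p) \<partial>distr P path_space (path \<xi>)) = (\<integral>v. f c (u * v) \<partial>\<nu>)"
proof -
  have "unit_valued Rplus (\<lambda>v. f c (u * v))"
    using assms by (intro win_function_unit_valued[OF win_function] measurable_times_Rplus) simp_all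
  then show ?thesis
    by (rule integral_path_law[OF unit_valuedD(1) assms(3)])
qed

abbreviation opp_win_prob :: "nat \<Rightarrow> real \<Rightarrow> real" where
  "opp_win_prob p \<equiv> win_prob f \<nu> (a 0) (a (opp p 0))"

lemma opp_0_less: "p \<in> {1..2*n-1} \<Longrightarrow> opp p 0 < 2 * n"
  using opp_0_range[of p] by auto

lemma zero_less: "0 < 2 * n"
  using n by simp

lemma unit_valued_opp_win_prob:
  assumes p: "p \<in> {1..2*n-1}"
  shows "unit_valued Rplus (opp_win_prob p)"
  using unit_valued_win_prob[OF win_function borel_prob a_nonneg[OF zero_less]
      a_nonneg[OF opp_0_less[OF p]]]
  by (simp add: unit_valued_marginal)

text \<open>With team 0's path frozen, the opponent's path enters only through its coordinate on day
  \<open>p\<close>, whose law is \<open>\<nu>\<close>.\<close>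

lemma path_law_win:
  assumes p: "p \<in> {1..2*n-1}" and x: "x \<in> space path_space"
  shows "(\<integral>y. f (a 0 * x p) (a (opp p 0) * y p) \<partial>distr P path_space (path \<xi>)) =
    opp_win_prob p (x p)"
proof -
  have "0 \<le> x p" using measurable_space[OF measurable_path_component x, of p] p by simp
  then show ?thesis
    unfolding win_prob_def using p opp_0_range[OF p] a_nonneg n
    by (intro integral_opponent_path) auto
qed

lemma unit_valued_game:
  assumes p: "p \<in> {1..2*n-1}"
  shows "unit_valued (path_space \<Otimes>\<^sub>M path_space)
    (\<lambda>(x, y). f (a 0 * x p) (a (opp p 0) * y p))"
  unfolding case_prod_beta using p opp_0_range[OF p] a_nonneg n
  by (intro win_function_unit_valued[OF win_function] measurable_times_Rplus
    measurable_compose[OF measurable_fst measurable_path_component]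
    measurable_compose[OF measurable_snd measurable_path_component]) auto

definition win_event :: "nat \<Rightarrow> 'b set" where
  "win_event p = {\<omega>\<in>space M. won 0 p \<omega>}"

lemma win_event_sets: "p \<in> {1..2*n-1} \<Longrightarrow> win_event p \<in> sets M"
  unfolding win_event_def using won_sets[of 0 p] n by simp

text \<open>Label 0 is the smallest, so every match of team 0 is listed from its side and
  \<open>won 0 p\<close> is covered by the conditional law.\<close>

lemma first_team_match: "p \<in> {1..2*n-1} \<Longrightarrow> (0, p) \<in> matches n opp"
  using opp_0_range[of p] n by (auto simp: matches_def)

lemma prob_win_event:
  assumes p: "p \<in> {1..2*n-1}"
  shows "M.prob (win_event p) = (\<integral>x. opp_win_prob p x \<partial>\<nu>)"
proof -
  let ?L = "distr P path_space (path \<xi>)"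
  let ?g = "\<lambda>x y. f (a 0 * x p) (a (opp p 0) * y p)"
  have j: "opp p 0 < 2 * n" "0 \<noteq> opp p 0" using opp_0_range[OF p] n by auto
  have "M.prob (win_event p) = M.expectation (\<lambda>\<omega>. ?g (path (X 0) \<omega>) (path (X (opp p 0)) \<omega>))"
    using prob_results[of "{(0, p)}"] first_team_match[OF p] p
    by (simp add: win_event_def strength_def path_apply)
  also have "\<dots> = (\<integral>x. \<integral>y. ?g x y \<partial>?L \<partial>?L)"
    using M.indep_pair_expectation[OF indep_paths _ _ j(2) unit_valued_game[OF p]] j zero_less
    by (simp only: distr_path lessThan_iff)
  also have "\<dots> = (\<integral>x. opp_win_prob p (x p) \<partial>?L)"
    using path_law_win[OF p] by (intro Bochner_Integration.integral_cong) auto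
  also have "\<dots> = (\<integral>x. opp_win_prob p x \<partial>\<nu>)"
    using p unit_valuedD(1)[OF unit_valued_opp_win_prob[OF p]] by (intro integral_path_law) auto
  finally show ?thesis .
qed

text \<open>The two opponents are different, so three independent paths are involved. Given the path
  of team 0 the two wins are independent, and their only dependence comes from team 0's own
  process.\<close>

lemma prob_two_win_events:
  assumes p: "p \<in> {1..2*n-1}" and q: "q \<in> {1..2*n-1}" and "p \<noteq> q"
  shows "M.prob (win_event p \<inter> win_event q) =
    expectation (\<lambda>\<omega>. opp_win_prob p (\<xi> p \<omega>) * opp_win_prob q (\<xi> q \<omega>))"
proof -
  let ?L = "distr P path_space (path \<xi>)"
  let ?g = "\<lambda>p x y. f (a 0 * x p) (a (opp p 0) * y p)"
  have j: "opp p 0 < 2 * n" "0 \<noteq> opp p 0" "opp q 0 < 2 * n" "0 \<noteq> opp q 0"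
    using opp_0_range[OF p] opp_0_range[OF q] n by auto
  have ne: "opp p 0 \<noteq> opp q 0"
    using inj_onD[OF bij_betw_imp_inj_on[OF opp_0_bij] _ p q] \<open>p \<noteq> q\<close> by blast
  have "win_event p \<inter> win_event q = {\<omega>\<in>space M. \<forall>(i, p)\<in>{(0, p), (0, q)}. won i p \<omega>}"
    by (auto simp: win_event_def)
  then have "M.prob (win_event p \<inter> win_event q) =
      M.expectation (\<lambda>\<omega>. ?g p (path (X 0) \<omega>) (path (X (opp p 0)) \<omega>) *
         ?g q (path (X 0) \<omega>) (path (X (opp q 0)) \<omega>))"
    using prob_results[of "{(0, p), (0, q)}"] first_team_match[OF p] first_team_match[OF q] assms
    by (simp add: strength_def path_apply)
  also have "\<dots> = (\<integral>x. (\<integral>y. ?g p x y \<partial>?L) * (\<integral>z. ?g q x z \<partial>?L) \<partial>?L)"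
    using M.indep_triple_expectation[OF indep_paths _ _ _ j(2,4) ne
        unit_valued_game[OF p] unit_valued_game[OF q]] j zero_less
    by (simp only: distr_path lessThan_iff)
  also have "\<dots> = (\<integral>x. opp_win_prob p (x p) * opp_win_prob q (x q) \<partial>?L)"
    using path_law_win[OF p] path_law_win[OF q]
    by (intro Bochner_Integration.integral_cong) auto
  \<comment> \<open>The path of team 0 has the law of the path of \<open>\<xi>\<close>, so the
    integral is an expectation under \<open>P\<close>.\<close>
  also have "\<dots> = expectation (\<lambda>\<omega>. opp_win_prob p (path \<xi> \<omega> p) * opp_win_prob q (path \<xi> \<omega> q))"
    using p q
    by (intro integral_distr measurable_path measurable_process borel_measurable_times
      measurable_compose[OF measurable_path_component unit_valuedD(1)[OF unit_valued_opp_win_prob]])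
      auto
  finally show ?thesis using p q by (simp add: path_apply)
qed

lemma covariance_win_events:
  assumes p: "p \<in> {1..2*n-1}" and q: "q \<in> {1..2*n-1}"
  shows "covariance M (indicator (win_event p)) (indicator (win_event q)) \<le>
    of_bool (p = q) + \<bar>lag_cov (opp_win_prob p) (opp_win_prob q) p q\<bar>"
proof (cases "p = q")
  case True
  then show ?thesis
    using M.covariance_abs_le_1[OF unit_valued_indicator unit_valued_indicator,
      OF win_event_sets[OF p] win_event_sets[OF q]] by simp
next
  case False
  have "M.expectation (\<lambda>\<omega>. indicator (win_event p) \<omega> * indicator (win_event q) \<omega>) =
      M.prob (win_event p \<inter> win_event q)"
    using win_event_sets[OF p] win_event_sets[OF q]
    by (simp add: indicator_inter_arith[symmetric])
  then have "covariance M (indicator (win_event p)) (indicator (win_event q)) =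
      lag_cov (opp_win_prob p) (opp_win_prob q) p q"
    using False p q win_event_sets[OF p] win_event_sets[OF q]
    by (simp add: covariance_def lag_cov_def prob_two_win_events prob_win_event
      expectation_process unit_valuedD(1)[OF unit_valued_opp_win_prob])
  then show ?thesis using False by simp
qed

definition total_wins :: "'b \<Rightarrow> real" where
  "total_wins \<omega> = (\<Sum>p=1..2*n-1. indicator (win_event p) \<omega>)"

lemma wins_eq: "\<omega> \<in> space M \<Longrightarrow> real (wins n won \<omega>) = total_wins \<omega>"
  by (simp add: wins_def total_wins_def win_event_def indicator_def sum.If_cases Int_def)

lemma unit_valued_win_event: "p \<in> {1..2*n-1} \<Longrightarrow> unit_valued M (indicator (win_event p))"
  by (intro unit_valued_indicator win_event_sets)

lemma expectation_total_wins:
  "M.expectation total_wins = (\<Sum>i=1..2*n-1. mean_win_prob f \<nu> (a 0) (a i))"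
proof -
  have "M.expectation total_wins = (\<Sum>p=1..2*n-1. M.expectation (indicator (win_event p)))"
    unfolding total_wins_def[abs_def]
    by (intro Bochner_Integration.integral_sum M.unit_valued_integrable unit_valued_win_event)
  also have "\<dots> = (\<Sum>p=1..2*n-1. mean_win_prob f \<nu> (a 0) (a (opp p 0)))"
    using win_event_sets by (intro sum.cong) (auto simp: prob_win_event mean_win_prob_def)
  \<comment> \<open>Summing over opponents instead of days removes the calendar from the
    mean.\<close>
  also have "\<dots> = (\<Sum>i=1..2*n-1. mean_win_prob f \<nu> (a 0) (a i))"
    by (rule sum.reindex_bij_betw[OF opp_0_bij])
  finally show ?thesis .
qed

text \<open>Chebyshev's inequality, with the variance expanded into covariances of single wins. The
  diagonal contributes at most \<open>2 * n - 1\<close>, rounded up to \<open>2 * n\<close>.\<close>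

lemma wins_deviation:
  assumes "\<delta> > 0"
  shows "M.prob {\<omega>\<in>space M. \<delta> \<le> \<bar>total_wins \<omega> - M.expectation total_wins\<bar>} \<le>
    (2 * real n + (\<Sum>p=1..2*n-1. \<Sum>q=1..2*n-1. \<bar>lag_cov (opp_win_prob p) (opp_win_prob q) p q\<bar>)) / \<delta>\<^sup>2"
proof -
  have [measurable]: "total_wins \<in> borel_measurable M"
    unfolding total_wins_def[abs_def]
    using win_event_sets by (intro borel_measurable_sum borel_measurable_indicator)
  have bnd: "\<bar>total_wins \<omega>\<bar> \<le> real (2 * n)" for \<omega>
  proof -
    have "\<bar>total_wins \<omega>\<bar> \<le> (\<Sum>p=1..2*n-1. 1)"
      unfolding total_wins_def by (rule order_trans[OF sum_abs sum_mono]) (simp add: indicator_def)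
    then show ?thesis using n by (simp add: of_nat_diff)
  qed
  have i1: "integrable M total_wins"
    using bnd by (intro M.integrable_const_bound[where B="real (2*n)"]) auto
  have i2: "integrable M (\<lambda>\<omega>. (total_wins \<omega>)\<^sup>2)"
  proof (rule M.integrable_const_bound[where B="(real (2*n))\<^sup>2"])
    show "AE \<omega> in M. norm ((total_wins \<omega>)\<^sup>2) \<le> (real (2*n))\<^sup>2"
      using power_mono[OF bnd abs_ge_zero, of _ 2] by (intro AE_I2) simp
  qed simp
  have "M.variance total_wins = covariance M total_wins total_wins"
    using M.variance_eq[OF i1 i2] by (simp add: covariance_def power2_eq_square)
  also have "\<dots> = (\<Sum>p=1..2*n-1. \<Sum>q=1..2*n-1.
      covariance M (indicator (win_event p)) (indicator (win_event q)))"
    unfolding total_wins_def[abs_def] by (intro M.covariance_sum_sum unit_valued_win_event)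
  also have "\<dots> \<le> (\<Sum>p=1..2*n-1. \<Sum>q=1..2*n-1. of_bool (p = q) +
      \<bar>lag_cov (opp_win_prob p) (opp_win_prob q) p q\<bar>)"
    by (intro sum_mono covariance_win_events)
  also have "\<dots> = (\<Sum>p=1..2*n-1. 1) + (\<Sum>p=1..2*n-1. \<Sum>q=1..2*n-1.
      \<bar>lag_cov (opp_win_prob p) (opp_win_prob q) p q\<bar>)"
    by (simp add: sum.distrib of_bool_def)
  finally have var: "M.variance total_wins \<le> 2 * real n + (\<Sum>p=1..2*n-1. \<Sum>q=1..2*n-1.
      \<bar>lag_cov (opp_win_prob p) (opp_win_prob q) p q\<bar>)"
    using n by (simp add: of_nat_diff)
  show ?thesis
    using M.Chebyshev_inequality[OF _ i2 assms] divide_right_mono[OF var, of "\<delta>\<^sup>2"] by simp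
qed

end

section \<open>From leagues of fixed size to the limit\<close>

lemma filterlim_odd: "filterlim (\<lambda>n::nat. 2 * n - 1) at_top sequentially"
  by (rule filterlim_at_top_mono[OF filterlim_ident]) (auto intro: eventually_sequentiallyI[of 1])

text \<open>There are \<open>2 * n - 1\<close> opponents but the normalization is
  \<open>2 * n\<close>; the correcting factor \<open>1 - 1 / (2 * n)\<close> tends to 1.\<close>

lemma mean_wins_tendsto:
  fixes g :: "nat \<Rightarrow> real"
  assumes "(\<lambda>N. (\<Sum>i=1..N. g i) / real N) \<longlonglongrightarrow> c"
  shows "(\<lambda>n. (\<Sum>i=1..2*n-1. g i) / real (2 * n)) \<longlonglongrightarrow> c"
proof -
  have "(\<lambda>n::nat. 1 - 1 / 2 * (1 / real n)) \<longlonglongrightarrow> 1 - 1 / 2 * 0"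
    by (intro tendsto_intros lim_1_over_n)
  from tendsto_mult[OF filterlim_compose[OF assms filterlim_odd] this]
  have "(\<lambda>n. (\<Sum>i=1..2*n-1. g i) / real (2*n-1) * (1 - 1 / 2 * (1 / real n))) \<longlonglongrightarrow> c" by simp
  moreover have "\<forall>\<^sub>F n in sequentially. (\<Sum>i=1..2*n-1. g i) / real (2*n-1) * (1 - 1 / 2 * (1 / real n)) =
      (\<Sum>i=1..2*n-1. g i) / real (2 * n)"
    using eventually_gt_at_top[of 0]
    by eventually_elim (simp add: of_nat_diff field_simps)
  ultimately show ?thesis by (rule Lim_transform_eventually)
qed

text \<open>The randomness of the initial strengths is reduced to the hypothesis
  \<open>mean\<close>. In the Chebyshev bound the diagonal contributes a term of order
  \<open>1 / n\<close>, and uniform weak mixing controls the rest.\<close>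

lemma (in stationary_mixing) wins_tendsto:
  fixes M :: "nat \<Rightarrow> 'b measure"
  assumes f: "win_function f" and a: "\<And>i. 0 \<le> a i"
    and cal: "\<And>n. 1 \<le> n \<Longrightarrow> calendar n (opp n)"
    and league: "\<And>n. 1 \<le> n \<Longrightarrow> league n (opp n) f a P \<xi> (M n) (X n) (won n)"
    and mean: "(\<lambda>N. (\<Sum>i=1..N. mean_win_prob f \<nu> (a 0) (a i)) / real N) \<longlonglongrightarrow> c"
  shows "tendsto_in_probability M (\<lambda>n \<omega>. real (wins n (won n) \<omega>) / real (2 * n)) c"
  unfolding tendsto_in_probability_def
proof (intro allI impI)
  fix \<epsilon> :: real assume "\<epsilon> > 0"
  let ?F = "win_prob f \<nu> (a 0)"
  let ?dev = "\<lambda>n. measure (M n) {\<omega>\<in>space (M n). \<bar>real (wins n (won n) \<omega>) / real (2 * n) - c\<bar> > \<epsilon>}"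
  have bp: "borel_prob_Rplus \<nu>"
    by (simp add: borel_prob_Rplus_def prob_space_marginal sets_marginal)
  have uF: "unit_valued \<nu> (?F u)" if "u \<in> {0..}" for u
    using unit_valued_win_prob[OF f bp a] that by simp
  have tb: "\<exists>R. finite R \<and> R \<subseteq> {0..} \<and> (\<forall>u\<in>{0..}. \<exists>r\<in>R. (\<integral>x. \<bar>?F u x - ?F r x\<bar> \<partial>\<nu>) \<le> \<eta>)"
    if "\<eta> > 0" for \<eta>
    using win_prob_antimono[OF f bp a]
    by (intro monotone_family_totally_bounded[OF prob_space_marginal uF _ that])
      (auto simp: space_marginal)
  have tends: "(\<lambda>n. 2 / \<epsilon>\<^sup>2 * (1 / real n)) \<longlonglongrightarrow> 0"
    using tendsto_mult[OF tendsto_const[of "2 / \<epsilon>\<^sup>2"] lim_1_over_n] by simp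
  show "?dev \<longlonglongrightarrow> 0"
  proof (rule tendstoI)
    fix \<delta> :: real assume "\<delta> > 0"
    \<comment> \<open>With at most \<open>4 * n^2\<close> pairs of days and the threshold
      \<open>\<epsilon> * n\<close> in Chebyshev's inequality, the covariances contribute at most
      \<open>4 * \<eta> / \<epsilon>^2 = \<delta> / 2\<close>.\<close>
    define \<eta> where "\<eta> = \<delta> * \<epsilon>\<^sup>2 / 8"
    have "\<eta> > 0" using \<open>\<delta> > 0\<close> \<open>\<epsilon> > 0\<close> by (simp add: \<eta>_def)
    \<comment> \<open>This is applied to \<open>u p = a (opp n p 0)\<close>, which changes with the
      calendar and so with \<open>n\<close>; hence \<open>u\<close> is quantified inside the
      eventuality.\<close>
    have ev1: "\<forall>\<^sub>F n in sequentially. \<forall>u. (\<forall>p\<in>{1..2*n-1}. u p \<in> {0..}) \<longrightarrow>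
      (\<Sum>p=1..2*n-1. \<Sum>q=1..2*n-1. \<bar>lag_cov (?F (u p)) (?F (u q)) p q\<bar>) \<le> \<eta> * (real (2*n-1))\<^sup>2"
      using eventually_compose_filterlim[OF lag_cov_uniform[OF _ tb \<open>\<eta> > 0\<close>] filterlim_odd] uF
      by (simp add: unit_valued_marginal)
    have ev2: "\<forall>\<^sub>F n in sequentially.
        \<bar>(\<Sum>i=1..2*n-1. mean_win_prob f \<nu> (a 0) (a i)) / real (2 * n) - c\<bar> < \<epsilon> / 2"
      using tendstoD[OF mean_wins_tendsto[OF mean], of "\<epsilon> / 2"] \<open>\<epsilon> > 0\<close> by (simp add: dist_real_def)
    have ev3: "\<forall>\<^sub>F n in sequentially. 2 / \<epsilon>\<^sup>2 * (1 / real n) < \<delta> / 2"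
      using tends by (rule order_tendstoD) (use \<open>\<delta> > 0\<close> in simp)
    show "\<forall>\<^sub>F n in sequentially. dist (?dev n) 0 < \<delta>"
      using ev1 ev2 ev3 eventually_ge_at_top[of 1]
    proof eventually_elim
      case (elim n)
      have n: "1 \<le> n" "0 < real n" using elim by auto
      interpret L: league_model P \<nu> \<xi> n "opp n" f a "M n" "X n" "won n"
        using n cal league f a by unfold_locales auto
      let ?V = "\<Sum>p=1..2*n-1. \<Sum>q=1..2*n-1. \<bar>lag_cov (L.opp_win_prob p) (L.opp_win_prob q) p q\<bar>"
      have d: "\<epsilon> * real n > 0" using \<open>\<epsilon> > 0\<close> n by simp
      \<comment> \<open>The normalized mean is within \<open>\<epsilon> / 2\<close> of
        \<open>c\<close>, so a deviation above \<open>\<epsilon>\<close> from \<open>c\<close>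
        leaves more than \<open>\<epsilon> / 2\<close> from the mean; multiplying by
        \<open>2 * n\<close> gives the threshold.\<close>
      have sub: "\<epsilon> * real n \<le> \<bar>L.total_wins \<omega> - L.M.expectation L.total_wins\<bar>"
        if "\<omega> \<in> space (M n)" "\<bar>real (wins n (won n) \<omega>) / real (2 * n) - c\<bar> > \<epsilon>" for \<omega>
      proof -
        have "\<bar>L.total_wins \<omega> / real (2 * n) - L.M.expectation L.total_wins / real (2 * n)\<bar> > \<epsilon> / 2"
          using that(2) elim(2) unfolding L.expectation_total_wins L.wins_eq[OF that(1)] by linarith
        then have "\<bar>(L.total_wins \<omega> - L.M.expectation L.total_wins) / real (2 * n)\<bar> > \<epsilon> / 2"
          by (simp add: diff_divide_distrib)
        then show ?thesis using n by (simp add: field_simps abs_divide)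
      qed
      have total_measurable: "L.total_wins \<in> borel_measurable (M n)"
        unfolding L.total_wins_def[abs_def]
        using L.win_event_sets by (intro borel_measurable_sum borel_measurable_indicator)
      have "?dev n \<le> L.M.prob {\<omega>\<in>space (M n). \<epsilon> * real n \<le> \<bar>L.total_wins \<omega> - L.M.expectation L.total_wins\<bar>}"
        using sub total_measurable by (intro L.M.finite_measure_mono) auto
      also have "\<dots> \<le> (2 * real n + ?V) / (\<epsilon> * real n)\<^sup>2"
        by (rule L.wins_deviation[OF d])
      also have "?V \<le> \<eta> * (real (2*n-1))\<^sup>2"
        using elim(1)[rule_format, of "\<lambda>p. a (opp n p 0)"] a by simp
      also have "\<dots> \<le> \<eta> * (2 * real n)\<^sup>2"
        using \<open>\<eta> > 0\<close> by (intro mult_left_mono power_mono) auto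
      finally have "?dev n \<le> (2 * real n + \<eta> * (2 * real n)\<^sup>2) / (\<epsilon> * real n)\<^sup>2"
        using d by (simp add: divide_right_mono)
      also have "\<dots> = 2 / \<epsilon>\<^sup>2 * (1 / real n) + \<delta> / 2"
        using n \<open>\<epsilon> > 0\<close> by (simp add: \<eta>_def field_simps power2_eq_square)
      also have "\<dots> < \<delta>" using elim(3) by simp
      finally show ?case by simp
    qed
  qed
qed

text \<open>The exceptional null set comes from the strong law for \<open>mean_win_prob\<close>
  alone. Outside it the result for fixed strengths covers every realization of the leagues, so these
  are quantified inside the almost sure statement.\<close>

theorem theorem1p3:
  fixes s :: real
    and f :: "real \<Rightarrow> real \<Rightarrow> real"
    and \<mu> \<nu> :: "real measure"
    and P :: "'a measure"
    and \<xi> :: "nat \<Rightarrow> 'a \<Rightarrow> real"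
    and opp :: "nat \<Rightarrow> nat \<Rightarrow> nat \<Rightarrow> nat"
  assumes "0 \<le> s"
    and "win_function f"
    and "borel_prob_Rplus \<mu>"
    and "borel_prob_Rplus \<nu>"
    and "strength_process P \<nu> \<xi>"
    and "\<forall>n\<ge>1. calendar n (opp n)"
  shows "(AE sv in PiM {1..} (\<lambda>_::nat. \<mu>).
            \<forall>(M :: nat \<Rightarrow> 'b measure) X won.
              (\<forall>n\<ge>1. league n (opp n) f (sv(0 := s)) P \<xi> (M n) (X n) (won n)) \<longrightarrow>
              tendsto_in_probability M
                (\<lambda>n \<omega>. real (wins n (won n) \<omega>) / real (2 * n)) (limit_wins f \<mu> \<nu> s)) \<and>
         (\<forall>(Q :: 'c measure) V V' U.
            prob_space Q \<and>
            prob_space.indep_vars Q (\<lambda>_. Rplus) (\<lambda>k. [V, V', U] ! k) {..<3::nat} \<and>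
            distr Q Rplus V = \<nu> \<and> distr Q Rplus V' = \<nu> \<and> distr Q Rplus U = \<mu> \<longrightarrow>
            limit_wins f \<mu> \<nu> s = (\<integral>\<omega>. f (s * V \<omega>) (U \<omega> * V' \<omega>) \<partial>Q))"
proof (intro conjI allI impI)
  interpret stationary_mixing P \<nu> \<xi> by unfold_locales fact
  have \<mu>: "prob_space \<mu>" "space \<mu> = {0..}"
    using assms(3) sets_eq_imp_space_eq[of \<mu> Rplus] by (simp_all add: borel_prob_Rplus_def)
  note lim = limit_wins_eq[OF assms(2-4,1)]
  have "AE sv in PiM {1..} (\<lambda>_::nat. \<mu>).
      (\<lambda>N. (\<Sum>i=1..N. mean_win_prob f \<nu> s (sv i)) / real N) \<longlonglongrightarrow> limit_wins f \<mu> \<nu> s"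
    unfolding lim(2) using unit_valuedD[OF lim(1)] by (intro strong_law_bounded \<mu>) auto
  moreover have "AE sv in PiM {1..} (\<lambda>_::nat. \<mu>). \<forall>i\<ge>1. 0 \<le> sv i"
    using \<mu>(2) by (intro AE_I2) (auto simp: space_PiM PiE_iff)
  ultimately show "AE sv in PiM {1..} (\<lambda>_::nat. \<mu>).
            \<forall>(M :: nat \<Rightarrow> 'b measure) X won.
              (\<forall>n\<ge>1. league n (opp n) f (sv(0 := s)) P \<xi> (M n) (X n) (won n)) \<longrightarrow>
              tendsto_in_probability M
                (\<lambda>n \<omega>. real (wins n (won n) \<omega>) / real (2 * n)) (limit_wins f \<mu> \<nu> s)"
  proof eventually_elim
    case (elim sv)
    \<comment> \<open>The product space has indices from 1 on; position 0 is filled with the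
      strength of team 0, which leaves the averages over opponents unchanged.\<close>
    let ?a = "sv(0 := s)"
    have "(\<Sum>i=1..N. mean_win_prob f \<nu> (?a 0) (?a i)) =
        (\<Sum>i=1..N. mean_win_prob f \<nu> s (sv i))" for N
      by (intro sum.cong) auto
    with elim(1) have mean: "(\<lambda>N. (\<Sum>i=1..N. mean_win_prob f \<nu> (?a 0) (?a i)) / real N)
        \<longlonglongrightarrow> limit_wins f \<mu> \<nu> s"
      by presburger
    have a: "0 \<le> ?a i" for i using elim(2) assms(1) by (cases "i = 0") auto
    show ?case
      using assms(6) by (intro allI impI wins_tendsto[OF assms(2) a _ _ mean]) blast+
  qed
next
  fix Q :: "'c measure" and V V' U
  assume "prob_space Q \<and>
            prob_space.indep_vars Q (\<lambda>_. Rplus) (\<lambda>k. [V, V', U] ! k) {..<3::nat} \<and>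
            distr Q Rplus V = \<nu> \<and> distr Q Rplus V' = \<nu> \<and> distr Q Rplus U = \<mu>"
  then show "limit_wins f \<mu> \<nu> s = (\<integral>\<omega>. f (s * V \<omega>) (U \<omega> * V' \<omega>) \<partial>Q)"
    by (intro limit_wins_indep[OF assms(2,1)]) auto
qed

end
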